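(* With the unit vector $\mathbf{d}$ and matrix $\mathbb{E}$ as defined in the context, suppose $\mathbb{E}$ is nonsingular and let $\tilde{\mathbf{\Theta}}=\mathbb{E}^{-1}\tilde{\mathbf{\Phi}}$. Then the function of $\gamma$ $$ \left\langle \delta(\gamma-\gamma_1) \prod_{i=2}^N \tilde{\phi}_i(\gamma_i), \mathcal{W} \prod_{i=1}^N \phi_i(\gamma_i) \right\rangle_{\mathcal{A}} $$ is equal to $$ \begin{aligned} \frac{1}{2}\frac{|\mathbb{E}|}{N!} \Big[& 2 \left( \mathbf{\Phi}(\gamma)^*\mathbf{d}\;\mathcal{W}_{\mathcal{P}}[\mathbf{\Phi}^*\tilde{\mathbf{\Theta}}](\gamma) -\mathbf{\Phi}(\gamma)^*\,\mathcal{W}_{\mathcal{P}}[\tilde{\mathbf{\Theta}}\mathbf{\Phi}^*\mathbf{d}](\gamma) \right)\\ &+ \mathbf{\Phi}(\gamma)^* \Big( \mathbf{d} \int \mathbf{\Phi}^*\tilde{\mathbf{\Theta}}\; \mathcal{W}_{\mathcal{P}}[\mathbf{\Phi}^*\tilde{\mathbf{\Theta}}] -\mathbf{\Phi}^*\, \mathcal{W}_{\mathcal{P}}[\tilde{\mathbf{\Theta}}\mathbf{\Phi}^*]\, \tilde{\mathbf{\Theta}}\; d\gamma'\\ &\qquad\qquad -2 \int \tilde{\mathbf{\Theta}}\; \mathcal{W}_{\mathcal{P}}[\mathbf{\Phi}^*\tilde{\mathbf{\Theta}}]\;\mathbf{\Phi}^*\mathbf{d} -\tilde{\mathbf{\Theta}}\,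 \mathbf{\Phi}^*\,\mathcal{W}_{\mathcal{P}}[\tilde{\mathbf{\Theta}}\mathbf{\Phi}^*\mathbf{d}]\; d\gamma' \Big) \Big], \end{aligned} $$ which can be computed with total cost $\mathcal{O}(N^3+N^2M\log M)$.
   Context: $N\ge1$ is an integer. A particle variable is $\gamma=(\mathbf{r},\sigma)$ with $\mathbf{r}\in\mathbb{R}^3$ and $\sigma\in\{-\frac12,\frac12\}$, and $\int f(\gamma)\,d\gamma=\sum_{\sigma}\int_{\mathbb{R}^3}f(\mathbf{r},\sigma)\,d\mathbf{r}$. The inner product is $\langle f,g\rangle=\int f\,\overline{g}$ (over $\gamma$, or over $\gamma_1,\dots,\gamma_N$ for $N$-particle functions). $\mathcal{W}$ is multiplication by $\frac12\sum_{i\ne j}\frac{1}{\|\mathbf{r}_i-\mathbf{r}_j\|}$ ($1\le i,j\le N$). The Poisson convolution is $\mathcal{W}_{\mathcal{P}}[f](\mathbf{r})=\int\frac{1}{\|\mathbf{r}-\mathbf{r}'\|}f(\gamma')\,d\gamma'$ (including the sum over the spin $\sigma'$), applied entrywise to vectors and matrices of functions; $\mathcal{W}_{\mathcal P}[f](\gamma)$ means its value at the spatial part of $\gamma$. $\phi_1,\dots,\phi_N$ and $\tilde\phi_1,\dots,\tilde\phi_N$ are complex-valued square-integrable functions of $\gamma$ such that all integrals written converge absolutely. $\mathbf{\Phi}=[\phi_1,\dots,\phi_N]^T$, $\tilde{\mathbf{\Phi}}=[\tilde\phi_1,\dots,\tilde\phi_N]^T$ (including $\tilde\phi_1$), and $^*$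 is conjugate transpose; products are matrix products with pointwise multiplication of functions, and functions under an integral in $\gamma'$ with no variable shown are evaluated at $\gamma'$. $|\cdot|$ is the determinant. $\mathcal{A}$ is the antisymmetrizer, $(\mathcal{A}F)(\gamma_1,\dots,\gamma_N)=\frac1{N!}\sum_{\pi\in S_N}\mathrm{sgn}(\pi)F(\gamma_{\pi(1)},\dots,\gamma_{\pi(N)})$, and $\langle F,G\rangle_{\mathcal{A}}=\langle\mathcal{A}F,\mathcal{A}G\rangle=\langle F,\mathcal{A}G\rangle$. The delta function $\delta(\gamma-\gamma_1)$ (Dirac in $\mathbf{r}$, Kronecker in $\sigma$) in the first slot means evaluation at $\gamma_1=\gamma$: $$\Big\langle\delta(\gamma-\gamma_1)\prod_{i=2}^N\tilde\phi_i(\gamma_i),G\Big\rangle_{\mathcal{A}}=\int\prod_{i=2}^N\tilde\phi_i(\gamma_i)\,\overline{(\mathcal{A}G)(\gamma,\gamma_2,\dots,\gamma_N)}\,d\gamma_2\cdots d\gamma_N .$$ $\mathbb{E}$ is the $N\times N$ matrix whose first row is $\mathbf{d}^*$ and whose row $i$, for $2\le i\le N$, is $[\langle\tilde\phi_i,\phi_1\rangle,\dots,\langle\tilde\phi_i,\phi_N\rangle]$, where $\mathbf{d}\in\mathbb{C}^N$ is chosen to be a unit vector such that $\mathbf{d}^*$ is orthogonal to the remaining rows of $\mathbb{E}$, i.e. $\sum_j\langle\tilde\phi_i,\phi_j\rangle d(j)=0$ for $2\le i\le N$. Cost model: the functions $\phi_i,\tilde\phi_i$ are given; representing, adding, scaling,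 multiplying pointwise or integrating one-particle functions costs $\mathcal{O}(M)$ each, with $N\le M$; applying $\mathcal{W}_{\mathcal{P}}$ to one function costs $\mathcal{O}(M\log M)$; scalar operations cost $\mathcal{O}(1)$; inverse, determinant and singular value decomposition of an $N\times N$ matrix cost $\mathcal{O}(N^3)$. *)

theory Defs
  imports
    "HOL-Analysis.Analysis"
    "HOL-Library.Landau_Symbols"
    "Jordan_Normal_Form.Schur_Decomposition"
begin

unbundle no vec_syntax

text \<open>The two constructors stand for the spin values $-1/2$ and $1/2$.  Indices of orbitals
  and particles run over \<open>{..<N}\<close>, so index 0 is the first particle.  The measure is
  \<open>lborel\<close> times counting measure; \<open>integral_particle\<close> below spells out
  the resulting integral as a sum over the spin.\<close>

datatype spin = Spin_Down | Spin_Up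

type_synonym particle = "(real ^ 3) \<times> spin"
type_synonym orbital = "particle \<Rightarrow> complex"

definition particle_measure :: "particle measure" where
  "particle_measure = lborel \<Otimes>\<^sub>M count_space UNIV"

lemma UNIV_spin: "UNIV = {Spin_Down, Spin_Up}"
  using spin.exhaust by auto

lemma integral_particle:
  fixes f :: orbital
  assumes "integrable particle_measure f"
  shows "(\<integral>x. f x \<partial>particle_measure) = (\<Sum>s\<in>UNIV. \<integral>r. f (r, s) \<partial>lborel)"
proof -
  have fin: "finite (UNIV :: spin set)"
    by (simp add: UNIV_spin)
  interpret C: sigma_finite_measure "count_space (UNIV :: spin set)"
    by (rule sigma_finite_measure_count_space_finite[OF fin])
  interpret P: pair_sigma_finite "lborel :: (real ^ 3) measure" "count_space (UNIV :: spin set)"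
    ..
  have "(\<integral>s. (\<integral>r. f (r, s) \<partial>lborel) \<partial>count_space UNIV) = (\<integral>x. f x \<partial>particle_measure)"
    using P.integral_snd[of "\<lambda>r s. f (r, s)"] assms by (simp add: particle_measure_def)
  then show ?thesis
    by (simp add: lebesgue_integral_count_space_finite[OF fin])
qed

definition braket :: "orbital \<Rightarrow> orbital \<Rightarrow> complex" where
  "braket f g = (\<integral>x. f x * cnj (g x) \<partial>particle_measure)"

definition poisson :: "orbital \<Rightarrow> orbital" where
  "poisson f x = (\<integral>y. complex_of_real (1 / norm (fst x - fst y)) * f y \<partial>particle_measure)"

definition poisson_vec :: "nat \<Rightarrow> (particle \<Rightarrow> complex vec) \<Rightarrow> particle \<Rightarrow> complex vec" where
  "poisson_vec N F x = vec N (\<lambda>i. poisson (\<lambda>y. F y $ i) x)"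

definition poisson_mat :: "nat \<Rightarrow> (particle \<Rightarrow> complex mat) \<Rightarrow> particle \<Rightarrow> complex mat" where
  "poisson_mat N F x = mat N N (\<lambda>(i, j). poisson (\<lambda>y. F y $$ (i, j)) x)"

definition integral_vec :: "nat \<Rightarrow> (particle \<Rightarrow> complex vec) \<Rightarrow> complex vec" where
  "integral_vec N F = vec N (\<lambda>i. \<integral>y. F y $ i \<partial>particle_measure)"

definition antisymmetrizer ::
    "nat \<Rightarrow> ((nat \<Rightarrow> particle) \<Rightarrow> complex) \<Rightarrow> (nat \<Rightarrow> particle) \<Rightarrow> complex" where
  "antisymmetrizer N F x =
     1 / fact N * (\<Sum>\<pi> | \<pi> permutes {..<N}. of_int (sign \<pi>) * F (\<lambda>i. x (\<pi> i)))"

definition coulomb :: "nat \<Rightarrow> (nat \<Rightarrow> particle) \<Rightarrow> complex" where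
  "coulomb N x =
     complex_of_real (1 / 2 * (\<Sum>i<N. \<Sum>j\<in>{..<N} - {i}. 1 / norm (fst (x i) - fst (x j))))"

text \<open>The delta function in the first slot: the first argument is set to \<open>\<gamma>\<close>, and only the
  remaining variables are integrated.\<close>

definition delta_braket ::
    "nat \<Rightarrow> (nat \<Rightarrow> orbital) \<Rightarrow> ((nat \<Rightarrow> particle) \<Rightarrow> complex) \<Rightarrow> orbital" where
  "delta_braket N \<phi>t G \<gamma> =
     (\<integral>x. (\<Prod>i\<in>{1..<N}. \<phi>t i (x i)) * cnj (antisymmetrizer N G (x(0 := \<gamma>)))
        \<partial>(Pi\<^sub>M {1..<N} (\<lambda>_. particle_measure)))"

definition orbital_vec :: "nat \<Rightarrow> (nat \<Rightarrow> orbital) \<Rightarrow> particle \<Rightarrow> complex vec" where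
  "orbital_vec N \<phi> x = vec N (\<lambda>i. \<phi> i x)"

definition E_mat :: "nat \<Rightarrow> (nat \<Rightarrow> orbital) \<Rightarrow> (nat \<Rightarrow> orbital) \<Rightarrow> complex vec \<Rightarrow> complex mat" where
  "E_mat N \<phi> \<phi>t d =
     mat N N (\<lambda>(i, j). if i = 0 then cnj (d $ j) else braket (\<phi>t i) (\<phi> j))"

definition Theta :: "nat \<Rightarrow> (nat \<Rightarrow> orbital) \<Rightarrow> (nat \<Rightarrow> orbital) \<Rightarrow> complex vec
    \<Rightarrow> particle \<Rightarrow> complex vec" where
  "Theta N \<phi> \<phi>t d x = the (mat_inverse (E_mat N \<phi> \<phi>t d)) *\<^sub>v orbital_vec N \<phi>t x"

text \<open>\<open>u \<bullet>* v\<close> is the scalar $u^* v$ and \<open>outer u v\<close> is the matrix $u v^*$.\<close>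

abbreviation adj_prod :: "complex vec \<Rightarrow> complex vec \<Rightarrow> complex" (infix \<open>\<bullet>*\<close> 70) where
  "u \<bullet>* v \<equiv> conjugate u \<bullet> v"

definition outer :: "complex vec \<Rightarrow> complex vec \<Rightarrow> complex mat" where
  "outer u v = mat (dim_vec u) (dim_vec v) (\<lambda>(i, j). u $ i * cnj (v $ j))"

definition closed_formula ::
    "nat \<Rightarrow> (nat \<Rightarrow> orbital) \<Rightarrow> (nat \<Rightarrow> orbital) \<Rightarrow> complex vec \<Rightarrow> orbital" where
  "closed_formula N \<phi> \<phi>t d \<gamma> =
     (let \<Phi> = orbital_vec N \<phi>;
          \<Theta> = Theta N \<phi> \<phi>t d;
          P = poisson (\<lambda>x. \<Phi> x \<bullet>* \<Theta> x);
          Q = poisson_vec N (\<lambda>x. outer (\<Theta> x) (\<Phi> x) *\<^sub>v d);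
          R = poisson_mat N (\<lambda>x. outer (\<Theta> x) (\<Phi> x))
      in 1 / 2 * (Determinant.det (E_mat N \<phi> \<phi>t d) / fact N) *
         (2 * ((\<Phi> \<gamma> \<bullet>* d) * P \<gamma> - \<Phi> \<gamma> \<bullet>* Q \<gamma>)
          + \<Phi> \<gamma> \<bullet>*
              ((\<integral>x. (\<Phi> x \<bullet>* \<Theta> x) * P x - \<Phi> x \<bullet>* (R x *\<^sub>v \<Theta> x) \<partial>particle_measure) \<cdot>\<^sub>v d
               - 2 \<cdot>\<^sub>v integral_vec N
                    (\<lambda>x. (P x * (\<Phi> x \<bullet>* d)) \<cdot>\<^sub>v \<Theta> x - outer (\<Theta> x) (\<Phi> x) *\<^sub>v Q x))))"

definition square_integrable :: "orbital \<Rightarrow> bool" where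
  "square_integrable f \<longleftrightarrow> f \<in> borel_measurable particle_measure \<and>
     integrable particle_measure (\<lambda>x. (norm (f x))\<^sup>2)"

text \<open>Expanding sums and products, every integral in the identity reduces to the overlaps
  \<open>braket (\<phi>t i) (\<phi> j)\<close>, which converge absolutely by square integrability, and to the one- and
  two-particle Coulomb integrals required to converge absolutely here.\<close>

definition admissible :: "nat \<Rightarrow> (nat \<Rightarrow> orbital) \<Rightarrow> (nat \<Rightarrow> orbital) \<Rightarrow> bool" where
  "admissible N \<phi> \<phi>t \<longleftrightarrow>
     (\<forall>i<N. square_integrable (\<phi> i) \<and> square_integrable (\<phi>t i)) \<and>
     (\<forall>i<N. \<forall>j<N. \<forall>x :: particle. integrable particle_measure
        (\<lambda>y. complex_of_real (1 / norm (fst x - fst y)) * (\<phi>t i y * cnj (\<phi> j y)))) \<and>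
     (\<forall>i<N. \<forall>j<N. \<forall>k<N. \<forall>l<N. integrable (particle_measure \<Otimes>\<^sub>M particle_measure)
        (\<lambda>(x, y). complex_of_real (1 / norm (fst x - fst y)) *
           (\<phi>t i x * cnj (\<phi> j x)) * (\<phi>t k y * cnj (\<phi> l y))))"

definition unit_null_vector ::
    "nat \<Rightarrow> (nat \<Rightarrow> orbital) \<Rightarrow> (nat \<Rightarrow> orbital) \<Rightarrow> complex vec \<Rightarrow> bool" where
  "unit_null_vector N \<phi> \<phi>t d \<longleftrightarrow>
     d \<in> carrier_vec N \<and> d \<bullet>* d = 1 \<and>
     (\<forall>i\<in>{1..<N}. (\<Sum>j<N. braket (\<phi>t i) (\<phi> j) * d $ j) = 0)"

definition nonsingular_setting ::
    "nat \<Rightarrow> (nat \<Rightarrow> orbital) \<Rightarrow> (nat \<Rightarrow> orbital) \<Rightarrow> complex vec \<Rightarrow> bool" where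
  "nonsingular_setting N \<phi> \<phi>t d \<longleftrightarrow>
     1 \<le> N \<and> admissible N \<phi> \<phi>t \<and> unit_null_vector N \<phi> \<phi>t d \<and>
     invertible_mat (E_mat N \<phi> \<phi>t d)"

text \<open>Computations are straight-line programs over scalar registers and one-particle function
  registers.  The first argument of an instruction is the target register, except that
  \<open>Mat_SVD\<close> has three targets.  An \<open>N \<times> N\<close> matrix occupies \<open>N\<^sup>2\<close> consecutive scalar registers,
  in row-major order.  The singular value decomposition is not unique, so its result is
  supplied by a function \<open>svd\<close>, about which a program may only assume \<open>svd_routine\<close>; a program
  knows the given orbitals only through the two loading instructions.\<close>

datatype instr =
    Sc_Const nat complex
  | Sc_Add nat nat nat
  | Sc_Mult nat nat nat
  | Sc_Divide nat nat nat
  | Sc_Conj nat nat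
  | Fn_Load_phi nat nat
  | Fn_Load_phit nat nat
  | Fn_Add nat nat nat
  | Fn_Scale nat nat nat
  | Fn_Mult nat nat nat
  | Fn_Conj nat nat
  | Fn_Integral nat nat
  | Fn_Poisson nat nat
  | Mat_Inverse nat nat
  | Mat_Det nat nat
  | Mat_SVD nat nat nat nat

type_synonym svd_result = "complex mat \<times> real vec \<times> complex mat"

definition is_svd :: "nat \<Rightarrow> complex mat \<Rightarrow> svd_result \<Rightarrow> bool" where
  "is_svd N A = (\<lambda>(U, s, V).
     U \<in> carrier_mat N N \<and> V \<in> carrier_mat N N \<and> s \<in> carrier_vec N \<and>
     mat_adjoint U * U = 1\<^sub>m N \<and> mat_adjoint V * V = 1\<^sub>m N \<and>
     (\<forall>i<N. 0 \<le> s $ i) \<and> (\<forall>i<N. \<forall>j<N. i \<le> j \<longrightarrow> s $ j \<le> s $ i) \<and>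
     A = U * mat N N (\<lambda>(i, j). if i = j then of_real (s $ i) else 0) * mat_adjoint V)"

definition svd_routine :: "nat \<Rightarrow> (complex mat \<Rightarrow> svd_result) \<Rightarrow> bool" where
  "svd_routine N svd \<longleftrightarrow> (\<forall>A\<in>carrier_mat N N. is_svd N A (svd A))"

record state =
  scalars :: "nat \<Rightarrow> complex"
  orbitals :: "nat \<Rightarrow> orbital"

definition set_scalar :: "nat \<Rightarrow> complex \<Rightarrow> state \<Rightarrow> state" where
  "set_scalar a c \<sigma> = \<sigma>\<lparr>scalars := (scalars \<sigma>)(a := c)\<rparr>"

definition set_function :: "nat \<Rightarrow> orbital \<Rightarrow> state \<Rightarrow> state" where
  "set_function a f \<sigma> = \<sigma>\<lparr>orbitals := (orbitals \<sigma>)(a := f)\<rparr>"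

definition get_mat :: "nat \<Rightarrow> nat \<Rightarrow> state \<Rightarrow> complex mat" where
  "get_mat N a \<sigma> = mat N N (\<lambda>(i, j). scalars \<sigma> (a + i * N + j))"

definition set_mat :: "nat \<Rightarrow> nat \<Rightarrow> complex mat \<Rightarrow> state \<Rightarrow> state" where
  "set_mat N a A \<sigma> = \<sigma>\<lparr>scalars := (\<lambda>k. if a \<le> k \<and> k < a + N * N
       then A $$ ((k - a) div N, (k - a) mod N) else scalars \<sigma> k)\<rparr>"

definition set_vec :: "nat \<Rightarrow> nat \<Rightarrow> real vec \<Rightarrow> state \<Rightarrow> state" where
  "set_vec N a v \<sigma> = \<sigma>\<lparr>scalars := (\<lambda>k. if a \<le> k \<and> k < a + N
       then of_real (v $ (k - a)) else scalars \<sigma> k)\<rparr>"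

fun exec_instr :: "nat \<Rightarrow> (complex mat \<Rightarrow> svd_result) \<Rightarrow> (nat \<Rightarrow> orbital) \<Rightarrow> (nat \<Rightarrow> orbital)
    \<Rightarrow> instr \<Rightarrow> state \<Rightarrow> state" where
  "exec_instr N svd \<phi> \<phi>t (Sc_Const a c) \<sigma> = set_scalar a c \<sigma>"
| "exec_instr N svd \<phi> \<phi>t (Sc_Add a b c) \<sigma> = set_scalar a (scalars \<sigma> b + scalars \<sigma> c) \<sigma>"
| "exec_instr N svd \<phi> \<phi>t (Sc_Mult a b c) \<sigma> = set_scalar a (scalars \<sigma> b * scalars \<sigma> c) \<sigma>"
| "exec_instr N svd \<phi> \<phi>t (Sc_Divide a b c) \<sigma> = set_scalar a (scalars \<sigma> b / scalars \<sigma> c) \<sigma>"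
| "exec_instr N svd \<phi> \<phi>t (Sc_Conj a b) \<sigma> = set_scalar a (cnj (scalars \<sigma> b)) \<sigma>"
| "exec_instr N svd \<phi> \<phi>t (Fn_Load_phi a i) \<sigma> = set_function a (\<phi> i) \<sigma>"
| "exec_instr N svd \<phi> \<phi>t (Fn_Load_phit a i) \<sigma> = set_function a (\<phi>t i) \<sigma>"
| "exec_instr N svd \<phi> \<phi>t (Fn_Add a b c) \<sigma> =
     set_function a (\<lambda>x. orbitals \<sigma> b x + orbitals \<sigma> c x) \<sigma>"
| "exec_instr N svd \<phi> \<phi>t (Fn_Scale a b c) \<sigma> =
     set_function a (\<lambda>x. scalars \<sigma> b * orbitals \<sigma> c x) \<sigma>"
| "exec_instr N svd \<phi> \<phi>t (Fn_Mult a b c) \<sigma> =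
     set_function a (\<lambda>x. orbitals \<sigma> b x * orbitals \<sigma> c x) \<sigma>"
| "exec_instr N svd \<phi> \<phi>t (Fn_Conj a b) \<sigma> = set_function a (\<lambda>x. cnj (orbitals \<sigma> b x)) \<sigma>"
| "exec_instr N svd \<phi> \<phi>t (Fn_Integral a b) \<sigma> =
     set_scalar a (\<integral>x. orbitals \<sigma> b x \<partial>particle_measure) \<sigma>"
| "exec_instr N svd \<phi> \<phi>t (Fn_Poisson a b) \<sigma> = set_function a (poisson (orbitals \<sigma> b)) \<sigma>"
| "exec_instr N svd \<phi> \<phi>t (Mat_Inverse a b) \<sigma> =
     set_mat N a (the (mat_inverse (get_mat N b \<sigma>))) \<sigma>"
| "exec_instr N svd \<phi> \<phi>t (Mat_Det a b) \<sigma> =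
     set_scalar a (Determinant.det (get_mat N b \<sigma>)) \<sigma>"
| "exec_instr N svd \<phi> \<phi>t (Mat_SVD u s v b) \<sigma> =
     (case svd (get_mat N b \<sigma>) of (U, S, V) \<Rightarrow> set_mat N v V (set_vec N s S (set_mat N u U \<sigma>)))"

definition initial_state :: state where
  "initial_state = \<lparr>scalars = (\<lambda>_. 0), orbitals = (\<lambda>_ _. 0)\<rparr>"

text \<open>The result is the content of function register 0.\<close>

definition program_output :: "nat \<Rightarrow> (complex mat \<Rightarrow> svd_result) \<Rightarrow> (nat \<Rightarrow> orbital)
    \<Rightarrow> (nat \<Rightarrow> orbital) \<Rightarrow> instr list \<Rightarrow> orbital" where
  "program_output N svd \<phi> \<phi>t p =
     orbitals (fold (exec_instr N svd \<phi> \<phi>t) p initial_state) 0"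

text \<open>Unit costs: \<open>cS\<close> for a scalar operation, \<open>cF\<close> for representing, adding, scaling,
  multiplying, conjugating or integrating one-particle functions of size \<open>M\<close>, \<open>cW\<close> for a
  Poisson convolution, and \<open>cL\<close> for the dense linear algebra routines.\<close>

fun instr_cost :: "real \<Rightarrow> (nat \<Rightarrow> real) \<Rightarrow> (nat \<Rightarrow> real) \<Rightarrow> (nat \<Rightarrow> real) \<Rightarrow> nat \<Rightarrow> nat
    \<Rightarrow> instr \<Rightarrow> real" where
  "instr_cost cS cF cW cL N M (Sc_Const _ _) = cS"
| "instr_cost cS cF cW cL N M (Sc_Add _ _ _) = cS"
| "instr_cost cS cF cW cL N M (Sc_Mult _ _ _) = cS"
| "instr_cost cS cF cW cL N M (Sc_Divide _ _ _) = cS"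
| "instr_cost cS cF cW cL N M (Sc_Conj _ _) = cS"
| "instr_cost cS cF cW cL N M (Fn_Load_phi _ _) = cF M"
| "instr_cost cS cF cW cL N M (Fn_Load_phit _ _) = cF M"
| "instr_cost cS cF cW cL N M (Fn_Add _ _ _) = cF M"
| "instr_cost cS cF cW cL N M (Fn_Scale _ _ _) = cF M"
| "instr_cost cS cF cW cL N M (Fn_Mult _ _ _) = cF M"
| "instr_cost cS cF cW cL N M (Fn_Conj _ _) = cF M"
| "instr_cost cS cF cW cL N M (Fn_Integral _ _) = cF M"
| "instr_cost cS cF cW cL N M (Fn_Poisson _ _) = cW M"
| "instr_cost cS cF cW cL N M (Mat_Inverse _ _) = cL N"
| "instr_cost cS cF cW cL N M (Mat_Det _ _) = cL N"
| "instr_cost cS cF cW cL N M (Mat_SVD _ _ _ _) = cL N"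

definition program_cost :: "real \<Rightarrow> (nat \<Rightarrow> real) \<Rightarrow> (nat \<Rightarrow> real) \<Rightarrow> (nat \<Rightarrow> real) \<Rightarrow> nat \<Rightarrow> nat
    \<Rightarrow> instr list \<Rightarrow> real" where
  "program_cost cS cF cW cL N M p = sum_list (map (instr_cost cS cF cW cL N M) p)"

end

theory Submission
  imports Defs
begin

text \<open>Expanding the antisymmetrizer turns the inner product into a sum over pairs of particles of
  Leibniz expansions of determinants: the matrix $E$ with its first row replaced by
  $\Phi(\gamma)^*$ and the rows of the interacting particles replaced by $\Phi(\gamma')^*$,
  $\Phi(\gamma'')^*$, integrated against the Coulomb kernel.  Multiplying by $E^{-1}$ from the right
  reduces such a determinant to $|E|$ times a minor of order 2 or 3.  The first
  column of $E^{-1}$ is $d$, and summing the other columns against the given functions yields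
  $\tilde\Theta$, so expanding the minors gives the closed formula.

  For the cost, a unit null vector is the last right singular vector of the matrix of overlaps with
  first row 0.  The formula is then evaluated with $O(N^2)$ operations on functions, the bottleneck
  being the Poisson convolution of the $N \times N$ matrix $\tilde\Theta \Phi^*$.\<close>

subsection \<open>Determinants with replaced rows\<close>

text \<open>The obstacle is that the Coulomb kernel couples two particles: after integration, the
  factor for the interacting rows k and l depends jointly on the two columns chosen for them, so the
  Leibniz sum is not a single determinant. It becomes a sum of determinants once the column j taken
  by row k is fixed: row k is then the j-th unit row, and row l is the corresponding slice of the
  two-particle integrals. Pairs containing the first particle are easier, because its position
  \<gamma> is not integrated: they leave one row of Coulomb potentials at \<gamma> and a minor of
  order 2. The closed formula is expanded in the same one- and two-particle integrals with
  coefficients from the inverse of E, so that both sides can be compared as finite sums.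
  Determinants are taken of functions of two indices rather than of matrix objects, because
  replacing a row is then a function update.\<close>

definition rowdet :: "nat \<Rightarrow> (nat \<Rightarrow> nat \<Rightarrow> complex) \<Rightarrow> complex" where
  "rowdet N A = Determinant.det (mat N N (\<lambda>(i, j). A i j))"

lemma rowdet_Leibniz:
  "rowdet N A = (\<Sum>\<pi> | \<pi> permutes {..<N}. of_int (sign \<pi>) * (\<Prod>i<N. A i (\<pi> i)))"
proof -
  have "(\<Prod>i = 0..<N. mat N N (\<lambda>(i, j). A i j) $$ (i, \<pi> i)) = (\<Prod>i<N. A i (\<pi> i))"
    if "\<pi> permutes {..<N}" for \<pi>
    using that permutes_in_image[OF that] by (intro prod.cong) (auto simp: atLeast0LessThan)
  then show ?thesis
    unfolding rowdet_def Determinant.det_def by (auto simp: atLeast0LessThan)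
qed

lemma rowdet_cong:
  assumes "\<And>i j. i < N \<Longrightarrow> j < N \<Longrightarrow> A i j = B i j"
  shows "rowdet N A = rowdet N B"
  unfolding rowdet_def by (rule arg_cong[of _ _ Determinant.det], rule eq_matI) (use assms in auto)

lemma prod_fun_upd_split:
  fixes N k :: nat and A :: "nat \<Rightarrow> nat \<Rightarrow> complex"
  assumes "k < N"
  shows "(\<Prod>i<N. (A(k := u)) i (\<pi> i)) = u (\<pi> k) * (\<Prod>i\<in>{..<N} - {k}. A i (\<pi> i))"
proof -
  have "(\<Prod>i<N. (A(k := u)) i (\<pi> i)) = u (\<pi> k) * (\<Prod>i\<in>{..<N} - {k}. (A(k := u)) i (\<pi> i))"
    using assms by (subst prod.remove[of _ k]) auto
  also have "(\<Prod>i\<in>{..<N} - {k}. (A(k := u)) i (\<pi> i)) = (\<Prod>i\<in>{..<N} - {k}. A i (\<pi> i))"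
    by (intro prod.cong) auto
  finally show ?thesis .
qed

lemma rowdet_row_sum:
  assumes "k < N"
  shows "rowdet N (A(k := \<lambda>j. \<Sum>i\<in>I. c i * R i j)) = (\<Sum>i\<in>I. c i * rowdet N (A(k := R i)))"
  unfolding rowdet_Leibniz prod_fun_upd_split[OF assms] sum_distrib_left sum_distrib_right
  by (subst sum.swap) (intro sum.cong refl, simp only: mult_ac)

lemma rowdet_row_add:
  assumes "k < N"
  shows "rowdet N (A(k := \<lambda>j. u j + v j)) = rowdet N (A(k := u)) + rowdet N (A(k := v))"
  unfolding rowdet_Leibniz prod_fun_upd_split[OF assms]
  by (simp add: algebra_simps sum.distrib)

lemma rowdet_equal_rows:
  assumes "i < N" "k < N" "i \<noteq> k" "A i = A k"
  shows "rowdet N A = 0"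
  unfolding rowdet_def
  by (rule det_identical_rows[of _ N i k]) (use assms in \<open>auto intro!: eq_vecI\<close>)

text \<open>Polarization: the determinant with u + v in both rows vanishes, and so do its terms with
  u twice or v twice; the two mixed terms must cancel.\<close>

lemma rowdet_swap_rows:
  assumes "i < N" "k < N" "i \<noteq> k"
  shows "rowdet N (A(i := u, k := v)) = - rowdet N (A(i := v, k := u))"
proof -
  let ?w = "\<lambda>j. u j + v j"
  have zero: "rowdet N (A(i := z, k := z)) = 0" for z
    using assms by (intro rowdet_equal_rows[of i N k]) auto
  have twist: "A(i := x, k := y) = A(k := y, i := x)" for x y
    using assms(3) by auto
  have "rowdet N (A(i := ?w, k := z)) = rowdet N (A(i := u, k := z)) + rowdet N (A(i := v, k := z))" for z
    unfolding twist by (rule rowdet_row_add[OF assms(1)])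
  then have "rowdet N (A(i := ?w, k := ?w)) = rowdet N (A(i := u, k := v)) + rowdet N (A(i := v, k := u))"
    by (simp only: rowdet_row_add[OF assms(2)] zero) simp
  then show ?thesis
    by (simp only: zero add_eq_0_iff2 eq_commute[of 0])
qed

lemma rowdet_replace2_Leibniz:
  assumes "h < N" "l < N" "h \<noteq> l"
  shows "rowdet N (A(h := u, l := v)) =
    (\<Sum>\<pi> | \<pi> permutes {..<N}. of_int (sign \<pi>) *
      (u (\<pi> h) * (v (\<pi> l) * (\<Prod>i\<in>{..<N} - {h, l}. A i (\<pi> i)))))"
proof -
  have "(\<Prod>i<N. (A(h := u, l := v)) i (\<pi> i))
      = u (\<pi> h) * (v (\<pi> l) * (\<Prod>i\<in>{..<N} - {h, l}. A i (\<pi> i)))" for \<pi>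
  proof -
    have "(\<Prod>i\<in>{..<N} - {l}. (A(h := u)) i (\<pi> i))
        = u (\<pi> h) * (\<Prod>i\<in>{..<N} - {l} - {h}. (A(h := u)) i (\<pi> i))"
      using assms by (subst prod.remove[of _ h]) auto
    also have "{..<N} - {l} - {h} = {..<N} - {h, l}" by auto
    also have "(\<Prod>i\<in>{..<N} - {h, l}. (A(h := u)) i (\<pi> i)) = (\<Prod>i\<in>{..<N} - {h, l}. A i (\<pi> i))"
      by (intro prod.cong) auto
    finally show ?thesis
      unfolding prod_fun_upd_split[OF assms(2)] by simp
  qed
  then show ?thesis by (simp only: rowdet_Leibniz)
qed

text \<open>\<open>W (\<pi> k) (\<pi> l)\<close> does not split into an entry of row k times an
  entry of row l. Summing over the value j of \<open>\<pi> k\<close> splits it: the unit row j in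
  row k selects the permutations with \<open>\<pi> k = j\<close>, and for these \<open>W j\<close>
  serves as row l.\<close>

lemma rowdet_replace3_Leibniz:
  assumes "h < N" "k < N" "l < N" "h \<noteq> k" "h \<noteq> l" "k \<noteq> l"
  shows "(\<Sum>\<pi> | \<pi> permutes {..<N}. of_int (sign \<pi>) *
      (u (\<pi> h) * (W (\<pi> k) (\<pi> l) * (\<Prod>i\<in>{..<N} - {h, k, l}. A i (\<pi> i)))))
    = (\<Sum>j<N. rowdet N (A(h := u, k := (\<lambda>m. if m = j then 1 else 0), l := W j)))"
proof -
  let ?e = "\<lambda>j m. if m = j then 1 else 0 :: complex"
  have "(\<Sum>j<N. rowdet N (A(h := u, k := ?e j, l := W j)))
      = (\<Sum>j<N. rowdet N (A(k := ?e j, h := u, l := W j)))"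
    using assms by (simp add: fun_upd_twist)
  also have "\<dots> = (\<Sum>\<pi> | \<pi> permutes {..<N}. \<Sum>j<N. of_int (sign \<pi>) *
      (u (\<pi> h) * (W j (\<pi> l) * (\<Prod>i\<in>{..<N} - {h, l}. (A(k := ?e j)) i (\<pi> i)))))"
    unfolding rowdet_replace2_Leibniz[OF assms(1,3,5)] by (rule sum.swap)
  also have "\<dots> = (\<Sum>\<pi> | \<pi> permutes {..<N}. of_int (sign \<pi>) *
      (u (\<pi> h) * (W (\<pi> k) (\<pi> l) * (\<Prod>i\<in>{..<N} - {h, k, l}. A i (\<pi> i)))))"
  proof (intro sum.cong refl)
    fix \<pi> assume "\<pi> \<in> {\<pi>. \<pi> permutes {..<N}}"
    then have \<pi>: "\<pi> k < N" using permutes_in_image[of \<pi> "{..<N}" k] assms by simp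
    have "(\<Prod>i\<in>{..<N} - {h, l}. (A(k := ?e j)) i (\<pi> i))
        = ?e j (\<pi> k) * (\<Prod>i\<in>{..<N} - {h, k, l}. A i (\<pi> i))" for j
    proof -
      have "(\<Prod>i\<in>{..<N} - {h, l}. (A(k := ?e j)) i (\<pi> i))
          = ?e j (\<pi> k) * (\<Prod>i\<in>{..<N} - {h, l} - {k}. (A(k := ?e j)) i (\<pi> i))"
        using assms by (subst prod.remove[of _ k]) auto
      also have "{..<N} - {h, l} - {k} = {..<N} - {h, k, l}" by auto
      also have "(\<Prod>i\<in>{..<N} - {h, k, l}. (A(k := ?e j)) i (\<pi> i))
          = (\<Prod>i\<in>{..<N} - {h, k, l}. A i (\<pi> i))"
        by (intro prod.cong) auto
      finally show ?thesis .
    qed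
    then have "(\<Sum>j<N. of_int (sign \<pi>) *
          (u (\<pi> h) * (W j (\<pi> l) * (\<Prod>i\<in>{..<N} - {h, l}. (A(k := ?e j)) i (\<pi> i)))))
        = (\<Sum>j<N. if \<pi> k = j then of_int (sign \<pi>) *
          (u (\<pi> h) * (W j (\<pi> l) * (\<Prod>i\<in>{..<N} - {h, k, l}. A i (\<pi> i)))) else 0)"
      by (intro sum.cong) auto
    then show "(\<Sum>j<N. of_int (sign \<pi>) *
          (u (\<pi> h) * (W j (\<pi> l) * (\<Prod>i\<in>{..<N} - {h, l}. (A(k := ?e j)) i (\<pi> i)))))
        = of_int (sign \<pi>) * (u (\<pi> h) * (W (\<pi> k) (\<pi> l) * (\<Prod>i\<in>{..<N} - {h, k, l}. A i (\<pi> i))))"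
      using \<pi> by simp
  qed
  finally show ?thesis by simp
qed

text \<open>Reading \<open>F\<close> as the inverse of \<open>E\<close>, these are the coordinates of the row \<open>u\<close> with respect to
  the rows of \<open>E\<close>.\<close>

definition row_coeff :: "nat \<Rightarrow> (nat \<Rightarrow> nat \<Rightarrow> complex) \<Rightarrow> (nat \<Rightarrow> complex) \<Rightarrow> nat \<Rightarrow> complex" where
  "row_coeff N F u i = (\<Sum>j<N. u j * F j i)"

locale row_inverse =
  fixes N :: nat and E F :: "nat \<Rightarrow> nat \<Rightarrow> complex"
  assumes left_inverse:
    "i < N \<Longrightarrow> j < N \<Longrightarrow> (\<Sum>m<N. F i m * E m j) = (if i = j then 1 else 0)"
begin

abbreviation "co \<equiv> row_coeff N F"

text \<open>Since F E = 1, u = (u F) E.\<close>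

lemma row_expansion:
  assumes "m < N"
  shows "(\<Sum>i<N. co u i * E i m) = u m"
proof -
  have "(\<Sum>i<N. co u i * E i m) = (\<Sum>j<N. u j * (\<Sum>i<N. F j i * E i m))"
    unfolding row_coeff_def sum_distrib_left sum_distrib_right
    by (subst sum.swap) (simp add: algebra_simps)
  also have "\<dots> = (\<Sum>j<N. if j = m then u j else 0)"
    by (intro sum.cong) (use assms in \<open>auto simp: left_inverse\<close>)
  finally show ?thesis using assms by simp
qed

lemma rowdet_replace:
  assumes "k < N"
  shows "rowdet N (A(k := u)) = (\<Sum>i<N. co u i * rowdet N (A(k := E i)))"
proof -
  have "rowdet N (A(k := u)) = rowdet N (A(k := \<lambda>m. \<Sum>i<N. co u i * E i m))"
    by (intro rowdet_cong) (auto simp: row_expansion)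
  then show ?thesis
    by (simp only: rowdet_row_sum[OF assms])
qed

text \<open>Cramer's rule for rows: when u is expanded in the rows of E, every row other than row k
  occurs twice and contributes nothing.\<close>

lemma rowdet_replace1:
  assumes "k < N"
  shows "rowdet N (E(k := u)) = rowdet N E * co u k"
proof -
  have "rowdet N (E(k := E i)) = 0" if "i < N" "i \<noteq> k" for i
    using that assms by (intro rowdet_equal_rows[of i N k]) auto
  then have "rowdet N (E(k := u)) = (\<Sum>i<N. if i = k then co u i * rowdet N E else 0)"
    by (subst rowdet_replace[OF assms], intro sum.cong) (auto simp: fun_upd_idem)
  then show ?thesis using assms by simp
qed

text \<open>Two terms survive when u is expanded. Row k returns to its place and leaves Cramer's
  rule for v in row l; row l, put in position k, has to be swapped back, which leaves Cramer's rule
  for v in row k with a minus sign.\<close>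

lemma rowdet_replace2:
  assumes "k < N" "l < N" "k \<noteq> l"
  shows "rowdet N (E(k := u, l := v)) = rowdet N E * (co u k * co v l - co u l * co v k)"
proof -
  let ?D = "\<lambda>i. rowdet N ((E(l := v))(k := E i))"
  have "?D i = 0" if "i < N" "i \<noteq> k" "i \<noteq> l" for i
    using that assms by (intro rowdet_equal_rows[of i N k]) auto
  then have "(\<Sum>i<N. co u i * ?D i) = (\<Sum>i\<in>{k, l}. co u i * ?D i)"
    using assms by (intro sum.mono_neutral_right) auto
  moreover have "?D k = rowdet N E * co v l"
    using assms rowdet_replace1[of l v] by (simp add: fun_upd_twist fun_upd_idem)
  moreover have "?D l = - (rowdet N E * co v k)"
    using assms rowdet_replace1[of k v] rowdet_swap_rows[of k N l E "E l" v]
    by (simp add: fun_upd_twist fun_upd_idem)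
  ultimately show ?thesis
    using assms rowdet_replace[of k "E(l := v)" u] by (simp add: fun_upd_twist algebra_simps)
qed

text \<open>In general, replacing rows of E by rows of a matrix R multiplies |E| by the minor of R
  E^{-1} in the replaced positions. Here the minor is Laplace expanded along u; the cofactors come
  from the rule for two rows, the signs from the swaps that return a row of E to its place.\<close>

lemma rowdet_replace3:
  assumes "h < N" "k < N" "l < N" "h \<noteq> k" "h \<noteq> l" "k \<noteq> l"
  shows "rowdet N (E(h := u, k := v, l := w)) = rowdet N E *
    (co u h * (co v k * co w l - co v l * co w k)
     - co u k * (co v h * co w l - co v l * co w h)
     + co u l * (co v h * co w k - co v k * co w h))"
proof -
  let ?D = "\<lambda>i. rowdet N ((E(k := v, l := w))(h := E i))"
  have "?D i = 0" if "i < N" "i \<noteq> h" "i \<noteq> k" "i \<noteq> l" for i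
    using that assms by (intro rowdet_equal_rows[of i N h]) auto
  then have "(\<Sum>i<N. co u i * ?D i) = (\<Sum>i\<in>{h, k, l}. co u i * ?D i)"
    using assms by (intro sum.mono_neutral_right) auto
  moreover have "?D h = rowdet N E * (co v k * co w l - co v l * co w k)"
  proof -
    have "(E(k := v, l := w))(h := E h) = E(k := v, l := w)"
      using assms by auto
    then show ?thesis
      by (simp only: rowdet_replace2[OF assms(2,3,6)])
  qed
  moreover have "?D k = - (rowdet N E * (co v h * co w l - co v l * co w h))"
  proof -
    have "?D k = rowdet N ((E(l := w))(h := E k, k := v))"
      by (rule arg_cong[of _ _ "rowdet N"]) (use assms in auto)
    also have "\<dots> = - rowdet N ((E(l := w))(h := v, k := E k))"
      using assms by (intro rowdet_swap_rows) auto
    also have "(E(l := w))(h := v, k := E k) = E(h := v, l := w)"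
      using assms by auto
    finally show ?thesis
      by (simp only: rowdet_replace2[OF assms(1,3,5)] mult_minus_right)
  qed
  \<comment> \<open>The swap moves w to position h, so w precedes v in this minor.\<close>
  moreover have "?D l = - (rowdet N E * (co w h * co v k - co w k * co v h))"
  proof -
    have "?D l = rowdet N ((E(k := v))(h := E l, l := w))"
      by (rule arg_cong[of _ _ "rowdet N"]) (use assms in auto)
    also have "\<dots> = - rowdet N ((E(k := v))(h := w, l := E l))"
      using assms by (intro rowdet_swap_rows) auto
    also have "(E(k := v))(h := w, l := E l) = E(h := w, k := v)"
      using assms by auto
    finally show ?thesis
      by (simp only: rowdet_replace2[OF assms(1,2,4)])
  qed
  moreover have "(E(k := v, l := w))(h := u) = E(h := u, k := v, l := w)"
    using assms by auto
  ultimately show ?thesis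
    using assms rowdet_replace[of h "E(k := v, l := w)" u] by (simp add: algebra_simps)
qed

end

subsection \<open>The closed formula in scalar form\<close>

lemma adj_prod_orbital_vec:
  "v \<in> carrier_vec N \<Longrightarrow> orbital_vec N \<phi> x \<bullet>* v = (\<Sum>j<N. cnj (\<phi> j x) * v $ j)"
  by (simp add: orbital_vec_def scalar_prod_def atLeast0LessThan)

lemma outer_mult_vec:
  assumes "v \<in> carrier_vec N" "i < N" "u \<in> carrier_vec N"
  shows "(outer u (orbital_vec N \<phi> x) *\<^sub>v v) $ i = u $ i * (\<Sum>j<N. cnj (\<phi> j x) * v $ j)"
  using assms
  by (auto simp: outer_def scalar_prod_def orbital_vec_def atLeast0LessThan sum_distrib_left mult.assoc)

text \<open>In the notation of the statement, \<open>\<beta>\<close> is $\Phi^* d$, \<open>\<rho>\<close> is $\Phi^* \Theta$, \<open>T\<close> is half the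
  first line of the formula, and \<open>c\<close> and \<open>H\<close> are the two integrals of the remaining lines.  Since
  the integrand defining \<open>H\<close> has \<open>T\<close> as a factor, \<open>T\<close> is computed only once.\<close>

locale theta_setting =
  fixes N :: nat and \<phi> \<phi>t :: "nat \<Rightarrow> orbital" and d :: "complex vec"
  assumes d_carrier: "d \<in> carrier_vec N"
    and inverse_carrier: "the (mat_inverse (E_mat N \<phi> \<phi>t d)) \<in> carrier_mat N N"
begin

definition F :: "nat \<Rightarrow> nat \<Rightarrow> complex" where
  "F i j = the (mat_inverse (E_mat N \<phi> \<phi>t d)) $$ (i, j)"

definition \<theta> :: "nat \<Rightarrow> orbital" where "\<theta> i x = (\<Sum>k<N. F i k * \<phi>t k x)"

definition \<beta> :: orbital where "\<beta> x = (\<Sum>j<N. cnj (\<phi> j x) * d $ j)"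

definition \<rho> :: orbital where "\<rho> x = (\<Sum>j<N. cnj (\<phi> j x) * \<theta> j x)"

definition T :: orbital where
  "T x = \<beta> x * poisson \<rho> x - (\<Sum>j<N. cnj (\<phi> j x) * poisson (\<lambda>y. \<theta> j y * \<beta> y) x)"

definition c :: complex where
  "c = (\<integral>x. \<rho> x * poisson \<rho> x - (\<Sum>i<N. \<Sum>j<N. cnj (\<phi> i x) *
     (poisson (\<lambda>y. \<theta> i y * cnj (\<phi> j y)) x * \<theta> j x)) \<partial>particle_measure)"

definition H :: "nat \<Rightarrow> complex" where "H i = (\<integral>x. \<theta> i x * T x \<partial>particle_measure)"

text \<open>A common meeting point: the output of the program and the expanded inner product are
  both compared with this form, in which only |E| still refers to a matrix.\<close>

lemma closed_formula_scalar:
  "closed_formula N \<phi> \<phi>t d \<gamma> = 1 / (2 * fact N) * Determinant.det (E_mat N \<phi> \<phi>t d) *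
     (2 * T \<gamma> + (c * \<beta> \<gamma> - 2 * (\<Sum>i<N. H i * cnj (\<phi> i \<gamma>))))"
proof -
  define \<Phi> where "\<Phi> = orbital_vec N \<phi>"
  define \<Theta> where "\<Theta> = Theta N \<phi> \<phi>t d"
  define P where "P = poisson (\<lambda>x. \<Phi> x \<bullet>* \<Theta> x)"
  define Q where "Q = poisson_vec N (\<lambda>x. outer (\<Theta> x) (\<Phi> x) *\<^sub>v d)"
  define R where "R = poisson_mat N (\<lambda>x. outer (\<Theta> x) (\<Phi> x))"
  define h where "h = integral_vec N (\<lambda>x. (P x * (\<Phi> x \<bullet>* d)) \<cdot>\<^sub>v \<Theta> x - outer (\<Theta> x) (\<Phi> x) *\<^sub>v Q x)"
  have carrier_\<Theta>: "\<Theta> x \<in> carrier_vec N" for x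
    using inverse_carrier by (simp add: \<Theta>_def Theta_def orbital_vec_def)
  have \<Theta>: "\<Theta> x $ i = \<theta> i x" if "i < N" for x i
    using that inverse_carrier
    by (simp add: \<Theta>_def Theta_def orbital_vec_def scalar_prod_def atLeast0LessThan F_def \<theta>_def)
  have \<Phi>d: "\<Phi> x \<bullet>* d = \<beta> x" for x
    by (simp add: \<Phi>_def adj_prod_orbital_vec[OF d_carrier] \<beta>_def)
  have \<Phi>\<Theta>: "\<Phi> x \<bullet>* \<Theta> x = \<rho> x" for x
    by (simp add: \<Phi>_def adj_prod_orbital_vec[OF carrier_\<Theta>] \<Theta> \<rho>_def)
  have P: "P = poisson \<rho>"
    by (simp add: P_def \<Phi>\<Theta>)
  have dim_Q: "Q x \<in> carrier_vec N" for x by (simp add: Q_def poisson_vec_def)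
  have Q: "Q x $ i = poisson (\<lambda>x. \<theta> i x * \<beta> x) x" if "i < N" for x i
    using that by (simp add: Q_def poisson_vec_def \<Phi>_def
        outer_mult_vec[OF d_carrier that carrier_\<Theta>] \<Theta> flip: \<beta>_def)
  have T: "T x = \<beta> x * P x - \<Phi> x \<bullet>* Q x" for x
    by (simp add: T_def \<Phi>_def adj_prod_orbital_vec[OF dim_Q] Q P)
  have dim_R: "R x \<in> carrier_mat N N" for x by (simp add: R_def poisson_mat_def)
  have R: "R x $$ (i, j) = poisson (\<lambda>x. \<theta> i x * cnj (\<phi> j x)) x" if "i < N" "j < N" for x i j
    using that carrier_vecD[OF carrier_\<Theta>]
    by (simp add: R_def poisson_mat_def outer_def \<Phi>_def orbital_vec_def \<Theta>)
  have "\<Phi> x \<bullet>* (R x *\<^sub>v \<Theta> x) = (\<Sum>i<N. \<Sum>j<N. cnj (\<phi> i x) *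
     (poisson (\<lambda>y. \<theta> i y * cnj (\<phi> j y)) x * \<theta> j x))" for x
  proof -
    have "\<Phi> x \<bullet>* (R x *\<^sub>v \<Theta> x) = (\<Sum>i<N. cnj (\<phi> i x) * (\<Sum>j<N. R x $$ (i, j) * \<Theta> x $ j))"
      unfolding \<Phi>_def adj_prod_orbital_vec[OF mult_mat_vec_carrier[OF dim_R carrier_\<Theta>]]
      using dim_R[of x] carrier_\<Theta>[of x]
      by (auto simp: scalar_prod_def atLeast0LessThan intro!: sum.cong)
    then show ?thesis by (simp add: R \<Theta> sum_distrib_left)
  qed
  then have c: "c = (\<integral>x. \<rho> x * P x - \<Phi> x \<bullet>* (R x *\<^sub>v \<Theta> x) \<partial>particle_measure)"
    by (simp add: c_def P)
  have dim_h: "h \<in> carrier_vec N" by (simp add: h_def integral_vec_def)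
  have h: "h $ i = H i" if "i < N" for i
  proof -
    have "((P x * (\<Phi> x \<bullet>* d)) \<cdot>\<^sub>v \<Theta> x - outer (\<Theta> x) (\<Phi> x) *\<^sub>v Q x) $ i = \<theta> i x * T x" for x
    proof -
      have "dim_vec (outer (\<Theta> x) (\<Phi> x) *\<^sub>v Q x) = N" "dim_vec (\<Theta> x) = N"
        using carrier_\<Theta>[of x] by (auto simp: outer_def)
      then show ?thesis
        using that outer_mult_vec[OF dim_Q[of x] that carrier_\<Theta>[of x], where \<phi> = \<phi> and x = x]
          adj_prod_orbital_vec[OF dim_Q[of x], of \<phi> x]
        by (simp add: T \<Phi>d \<Theta> \<Phi>_def[symmetric] algebra_simps)
    qed
    then show ?thesis using that by (simp add: h_def H_def integral_vec_def)
  qed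
  have "\<Phi> \<gamma> \<bullet>* (c \<cdot>\<^sub>v d - 2 \<cdot>\<^sub>v h) = c * \<beta> \<gamma> - 2 * (\<Sum>i<N. H i * cnj (\<phi> i \<gamma>))"
  proof -
    have *: "c \<cdot>\<^sub>v d - 2 \<cdot>\<^sub>v h \<in> carrier_vec N" using d_carrier dim_h by simp
    have "(\<Sum>i<N. cnj (\<phi> i \<gamma>) * (c \<cdot>\<^sub>v d - 2 \<cdot>\<^sub>v h) $ i)
        = (\<Sum>i<N. c * (cnj (\<phi> i \<gamma>) * d $ i) - 2 * (H i * cnj (\<phi> i \<gamma>)))"
      using d_carrier dim_h by (intro sum.cong) (auto simp: h algebra_simps)
    then show ?thesis
      unfolding \<Phi>_def adj_prod_orbital_vec[OF *] \<beta>_def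
      by (simp add: sum_subtractf sum_distrib_left)
  qed
  then show ?thesis
    unfolding closed_formula_def Let_def
    unfolding \<Phi>_def[symmetric] \<Theta>_def[symmetric]
    unfolding P_def[symmetric] Q_def[symmetric] R_def[symmetric]
    unfolding h_def[symmetric]
    unfolding \<Phi>\<Theta> c[symmetric] \<Phi>d T
    by simp
qed

end

subsection \<open>Straight-line programs for expressions\<close>

text \<open>The recursion is mutual because integrals turn functions into scalars and scaling feeds
  scalars back into functions. The dense matrix routines stay outside; the program uses only three
  such instructions.\<close>

datatype sexp = SConst complex | SReg nat | SConj sexp | SMul sexp sexp | SInt fexp
and fexp = FReg nat | FPhi nat | FPhit nat | FConj fexp | FAdd fexp fexp | FMul fexp fexp
  | FScale sexp fexp | FPoisson fexp

primrec seval :: "(nat \<Rightarrow> orbital) \<Rightarrow> (nat \<Rightarrow> orbital) \<Rightarrow> state \<Rightarrow> sexp \<Rightarrow> complex"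
  and feval :: "(nat \<Rightarrow> orbital) \<Rightarrow> (nat \<Rightarrow> orbital) \<Rightarrow> state \<Rightarrow> fexp \<Rightarrow> orbital" where
  "seval \<phi> \<phi>t \<sigma> (SConst c) = c"
| "seval \<phi> \<phi>t \<sigma> (SReg a) = scalars \<sigma> a"
| "seval \<phi> \<phi>t \<sigma> (SConj e) = cnj (seval \<phi> \<phi>t \<sigma> e)"
| "seval \<phi> \<phi>t \<sigma> (SMul e e') = seval \<phi> \<phi>t \<sigma> e * seval \<phi> \<phi>t \<sigma> e'"
| "seval \<phi> \<phi>t \<sigma> (SInt f) = (\<integral>x. feval \<phi> \<phi>t \<sigma> f x \<partial>particle_measure)"
| "feval \<phi> \<phi>t \<sigma> (FReg a) = orbitals \<sigma> a"
| "feval \<phi> \<phi>t \<sigma> (FPhi i) = \<phi> i"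
| "feval \<phi> \<phi>t \<sigma> (FPhit i) = \<phi>t i"
| "feval \<phi> \<phi>t \<sigma> (FConj f) = (\<lambda>x. cnj (feval \<phi> \<phi>t \<sigma> f x))"
| "feval \<phi> \<phi>t \<sigma> (FAdd f g) = (\<lambda>x. feval \<phi> \<phi>t \<sigma> f x + feval \<phi> \<phi>t \<sigma> g x)"
| "feval \<phi> \<phi>t \<sigma> (FMul f g) = (\<lambda>x. feval \<phi> \<phi>t \<sigma> f x * feval \<phi> \<phi>t \<sigma> g x)"
| "feval \<phi> \<phi>t \<sigma> (FScale e f) = (\<lambda>x. seval \<phi> \<phi>t \<sigma> e * feval \<phi> \<phi>t \<sigma> f x)"
| "feval \<phi> \<phi>t \<sigma> (FPoisson f) = poisson (feval \<phi> \<phi>t \<sigma> f)"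

text \<open>If only registers below r are read, code with scratch space from r on cannot destroy its
  own inputs.\<close>

primrec sbelow :: "nat \<Rightarrow> sexp \<Rightarrow> bool" and fbelow :: "nat \<Rightarrow> fexp \<Rightarrow> bool" where
  "sbelow r (SConst c) = True"
| "sbelow r (SReg a) = (a < r)"
| "sbelow r (SConj e) = sbelow r e"
| "sbelow r (SMul e e') = (sbelow r e \<and> sbelow r e')"
| "sbelow r (SInt f) = fbelow r f"
| "fbelow r (FReg a) = (a < r)"
| "fbelow r (FPhi i) = True"
| "fbelow r (FPhit i) = True"
| "fbelow r (FConj f) = fbelow r f"
| "fbelow r (FAdd f g) = (fbelow r f \<and> fbelow r g)"
| "fbelow r (FMul f g) = (fbelow r f \<and> fbelow r g)"
| "fbelow r (FScale e f) = (sbelow r e \<and> fbelow r f)"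
| "fbelow r (FPoisson f) = fbelow r f"

text \<open>The compiled code of an expression leaves its value in register \<open>r\<close> and writes only to
  registers from \<open>r\<close> on.  The instruction set has no copying instruction, so registers are copied
  by adding 0 or scaling by 1.\<close>

primrec scompile :: "sexp \<Rightarrow> nat \<Rightarrow> instr list" and fcompile :: "fexp \<Rightarrow> nat \<Rightarrow> instr list" where
  "scompile (SConst c) r = [Sc_Const r c]"
| "scompile (SReg a) r = [Sc_Const r 0, Sc_Add r a r]"
| "scompile (SConj e) r = scompile e r @ [Sc_Conj r r]"
| "scompile (SMul e e') r = scompile e r @ scompile e' (Suc r) @ [Sc_Mult r r (Suc r)]"
| "scompile (SInt f) r = fcompile f r @ [Fn_Integral r r]"
| "fcompile (FReg a) r = [Sc_Const r 1, Fn_Scale r r a]"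
| "fcompile (FPhi i) r = [Fn_Load_phi r i]"
| "fcompile (FPhit i) r = [Fn_Load_phit r i]"
| "fcompile (FConj f) r = fcompile f r @ [Fn_Conj r r]"
| "fcompile (FAdd f g) r = fcompile f r @ fcompile g (Suc r) @ [Fn_Add r r (Suc r)]"
| "fcompile (FMul f g) r = fcompile f r @ fcompile g (Suc r) @ [Fn_Mult r r (Suc r)]"
| "fcompile (FScale e f) r = scompile e r @ fcompile f (Suc r) @ [Fn_Scale r r (Suc r)]"
| "fcompile (FPoisson f) r = fcompile f r @ [Fn_Poisson r r]"

lemma below_mono:
  "sbelow r e \<Longrightarrow> r \<le> r' \<Longrightarrow> sbelow r' e"
  "fbelow r f \<Longrightarrow> r \<le> r' \<Longrightarrow> fbelow r' f"
  by (induction e and f) auto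

definition agree :: "nat \<Rightarrow> state \<Rightarrow> state \<Rightarrow> bool" where
  "agree r \<sigma> \<tau> \<longleftrightarrow> (\<forall>a<r. scalars \<sigma> a = scalars \<tau> a \<and> orbitals \<sigma> a = orbitals \<tau> a)"

lemma eval_agree:
  "sbelow r e \<Longrightarrow> agree r \<sigma> \<tau> \<Longrightarrow> seval \<phi> \<phi>t \<sigma> e = seval \<phi> \<phi>t \<tau> e"
  "fbelow r f \<Longrightarrow> agree r \<sigma> \<tau> \<Longrightarrow> feval \<phi> \<phi>t \<sigma> f = feval \<phi> \<phi>t \<tau> f"
  by (induction e and f) (auto simp: agree_def)

lemma state_simps [simp]:
  "scalars (set_scalar a c \<sigma>) = (scalars \<sigma>)(a := c)"
  "orbitals (set_scalar a c \<sigma>) = orbitals \<sigma>"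
  "scalars (set_function a f \<sigma>) = scalars \<sigma>"
  "orbitals (set_function a f \<sigma>) = (orbitals \<sigma>)(a := f)"
  by (simp_all add: set_scalar_def set_function_def)

locale machine =
  fixes N :: nat and svd :: "complex mat \<Rightarrow> svd_result" and \<phi> \<phi>t :: "nat \<Rightarrow> orbital"
begin

abbreviation "run \<equiv> fold (exec_instr N svd \<phi> \<phi>t)"
abbreviation "sval \<equiv> seval \<phi> \<phi>t"
abbreviation "fval \<equiv> feval \<phi> \<phi>t"

text \<open>The situation of a binary operation: the first operand waits in register r while the
  second is computed from \<open>Suc r\<close> on.\<close>

lemma compile_pair:
  assumes "agree r \<sigma>1 \<sigma>" "agree (Suc r) \<sigma>2 \<sigma>1"
  shows "agree r \<sigma>2 \<sigma>" "scalars \<sigma>2 r = scalars \<sigma>1 r" "orbitals \<sigma>2 r = orbitals \<sigma>1 r"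
  using assms by (auto simp: agree_def)

lemma compile_correct:
  "sbelow r e \<Longrightarrow> agree r (run (scompile e r) \<sigma>) \<sigma> \<and> scalars (run (scompile e r) \<sigma>) r = sval \<sigma> e"
  "fbelow r f \<Longrightarrow> agree r (run (fcompile f r) \<sigma>) \<sigma> \<and> orbitals (run (fcompile f r) \<sigma>) r = fval \<sigma> f"
proof (induction e and f arbitrary: r \<sigma> and r \<sigma>)
  case (SMul e e')
  define \<sigma>1 where "\<sigma>1 = run (scompile e r) \<sigma>"
  define \<sigma>2 where "\<sigma>2 = run (scompile e' (Suc r)) \<sigma>1"
  have 1: "agree r \<sigma>1 \<sigma>" "scalars \<sigma>1 r = sval \<sigma> e"
    using SMul.IH(1)[of r \<sigma>] SMul.prems by (auto simp: \<sigma>1_def)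
  have 2: "agree (Suc r) \<sigma>2 \<sigma>1" "scalars \<sigma>2 (Suc r) = sval \<sigma>1 e'"
    using SMul.IH(2)[of "Suc r" \<sigma>1] SMul.prems below_mono(1)[of r e' "Suc r"] by (auto simp: \<sigma>2_def)
  show ?case
    using compile_pair[OF 1(1) 2(1)] 1 2 eval_agree(1)[of r e' \<sigma>1 \<sigma>] SMul.prems
    by (auto simp: \<sigma>1_def[symmetric] \<sigma>2_def[symmetric]) (auto simp: agree_def)
next
  case (FAdd f g)
  define \<sigma>1 where "\<sigma>1 = run (fcompile f r) \<sigma>"
  define \<sigma>2 where "\<sigma>2 = run (fcompile g (Suc r)) \<sigma>1"
  have 1: "agree r \<sigma>1 \<sigma>" "orbitals \<sigma>1 r = fval \<sigma> f"
    using FAdd.IH(1)[of r \<sigma>] FAdd.prems by (auto simp: \<sigma>1_def)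
  have 2: "agree (Suc r) \<sigma>2 \<sigma>1" "orbitals \<sigma>2 (Suc r) = fval \<sigma>1 g"
    using FAdd.IH(2)[of "Suc r" \<sigma>1] FAdd.prems below_mono(2)[of r g "Suc r"] by (auto simp: \<sigma>2_def)
  show ?case
    using compile_pair[OF 1(1) 2(1)] 1 2 eval_agree(2)[of r g \<sigma>1 \<sigma>] FAdd.prems
    by (auto simp: \<sigma>1_def[symmetric] \<sigma>2_def[symmetric]) (auto simp: agree_def)
next
  case (FMul f g)
  define \<sigma>1 where "\<sigma>1 = run (fcompile f r) \<sigma>"
  define \<sigma>2 where "\<sigma>2 = run (fcompile g (Suc r)) \<sigma>1"
  have 1: "agree r \<sigma>1 \<sigma>" "orbitals \<sigma>1 r = fval \<sigma> f"
    using FMul.IH(1)[of r \<sigma>] FMul.prems by (auto simp: \<sigma>1_def)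
  have 2: "agree (Suc r) \<sigma>2 \<sigma>1" "orbitals \<sigma>2 (Suc r) = fval \<sigma>1 g"
    using FMul.IH(2)[of "Suc r" \<sigma>1] FMul.prems below_mono(2)[of r g "Suc r"] by (auto simp: \<sigma>2_def)
  show ?case
    using compile_pair[OF 1(1) 2(1)] 1 2 eval_agree(2)[of r g \<sigma>1 \<sigma>] FMul.prems
    by (auto simp: \<sigma>1_def[symmetric] \<sigma>2_def[symmetric]) (auto simp: agree_def)
next
  case (FScale e g)
  define \<sigma>1 where "\<sigma>1 = run (scompile e r) \<sigma>"
  define \<sigma>2 where "\<sigma>2 = run (fcompile g (Suc r)) \<sigma>1"
  have 1: "agree r \<sigma>1 \<sigma>" "scalars \<sigma>1 r = sval \<sigma> e"
    using FScale.IH(1)[of r \<sigma>] FScale.prems by (auto simp: \<sigma>1_def)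
  have 2: "agree (Suc r) \<sigma>2 \<sigma>1" "orbitals \<sigma>2 (Suc r) = fval \<sigma>1 g"
    using FScale.IH(2)[of "Suc r" \<sigma>1] FScale.prems below_mono(2)[of r g "Suc r"] by (auto simp: \<sigma>2_def)
  show ?case
    using compile_pair[OF 1(1) 2(1)] 1 2 eval_agree(2)[of r g \<sigma>1 \<sigma>] FScale.prems
    by (auto simp: \<sigma>1_def[symmetric] \<sigma>2_def[symmetric]) (auto simp: agree_def)
qed (auto simp: agree_def)

end

section \<open>Assignments, loops of assignments and their frame conditions\<close>

definition sassign :: "nat \<Rightarrow> nat \<Rightarrow> sexp \<Rightarrow> instr list" where
  "sassign r a e = scompile e r @ [Sc_Const (Suc r) 0, Sc_Add a r (Suc r)]"

definition fassign :: "nat \<Rightarrow> nat \<Rightarrow> fexp \<Rightarrow> instr list" where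
  "fassign r a f = fcompile f r @ [Sc_Const r 1, Fn_Scale a r r]"

text \<open>A frame condition with separate exception sets for scalar and function registers.
  Nothing is claimed about the scratch registers from r on.\<close>

definition unchanged :: "nat \<Rightarrow> nat set \<Rightarrow> nat set \<Rightarrow> state \<Rightarrow> state \<Rightarrow> bool" where
  "unchanged r A B \<sigma> \<tau> \<longleftrightarrow> (\<forall>a<r. a \<notin> A \<longrightarrow> scalars \<tau> a = scalars \<sigma> a) \<and>
     (\<forall>a<r. a \<notin> B \<longrightarrow> orbitals \<tau> a = orbitals \<sigma> a)"

lemma unchanged_scalar: "unchanged r A B \<sigma> \<tau> \<Longrightarrow> a < r \<Longrightarrow> a \<notin> A \<Longrightarrow> scalars \<tau> a = scalars \<sigma> a"
  and unchanged_orbital: "unchanged r A B \<sigma> \<tau> \<Longrightarrow> a < r \<Longrightarrow> a \<notin> B \<Longrightarrow> orbitals \<tau> a = orbitals \<sigma> a"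
  by (simp_all add: unchanged_def)

context machine
begin

lemma run_sassign:
  assumes "sbelow r e" "a < r"
  shows "unchanged r {a} {} \<sigma> (run (sassign r a e) \<sigma>)"
    and "scalars (run (sassign r a e) \<sigma>) a = sval \<sigma> e"
  using compile_correct(1)[OF assms(1), of \<sigma>] assms(2)
  by (auto simp: sassign_def agree_def unchanged_def)

lemma run_fassign:
  assumes "fbelow r f" "a < r"
  shows "unchanged r {} {a} \<sigma> (run (fassign r a f) \<sigma>)"
    and "orbitals (run (fassign r a f) \<sigma>) a = fval \<sigma> f"
  using compile_correct(2)[OF assms(1), of \<sigma>] assms(2)
  by (auto simp: fassign_def agree_def unchanged_def)

text \<open>The value of each expression is required in every state that differs from the starting
  state only at the targets and in scratch space. The iterations are therefore independent, and an
  earlier one cannot disturb a later one.\<close>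

lemma run_sassign_loop:
  assumes "\<And>i. i < n \<Longrightarrow> sbelow r (e i) \<and> a i < r" "inj_on a {..<n}"
    and "\<And>i \<tau>. i < n \<Longrightarrow> unchanged r (a ` {..<n}) {} \<sigma> \<tau> \<Longrightarrow> sval \<tau> (e i) = v i"
  defines "\<sigma>' \<equiv> run (concat (map (\<lambda>i. sassign r (a i) (e i)) [0..<n])) \<sigma>"
  shows "unchanged r (a ` {..<n}) {} \<sigma> \<sigma>'" and "\<And>i. i < n \<Longrightarrow> scalars \<sigma>' (a i) = v i"
proof -
  define s where "s m = run (concat (map (\<lambda>i. sassign r (a i) (e i)) [0..<m])) \<sigma>" for m
  have "unchanged r (a ` {..<n}) {} \<sigma> (s m) \<and> (\<forall>i<m. scalars (s m) (a i) = v i)" if "m \<le> n" for m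
    using that
  proof (induction m)
    case 0
    then show ?case by (simp add: s_def unchanged_def)
  next
    case (Suc m)
    have s: "s (Suc m) = run (sassign r (a m) (e m)) (s m)"
      by (simp add: s_def)
    have IH: "unchanged r (a ` {..<n}) {} \<sigma> (s m)" "\<forall>i<m. scalars (s m) (a i) = v i"
      using Suc by auto
    have below: "sbelow r (e m)" "a m < r"
      using assms(1)[of m] Suc.prems by auto
    note step = run_sassign[OF below, of "s m", folded s]
    have "scalars (s (Suc m)) (a m) = v m"
      using step(2) assms(3)[of m "s m"] IH(1) Suc.prems by simp
    moreover have "a i \<noteq> a m" if "i < m" for i
      using inj_onD[OF assms(2), of i m] that Suc.prems by auto
    moreover have "a i < r" if "i < m" for i
      using assms(1)[of i] that Suc.prems by auto
    ultimately have "\<forall>i<Suc m. scalars (s (Suc m)) (a i) = v i"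
      using step(1) IH(2) by (auto simp: unchanged_def less_Suc_eq)
    moreover have "unchanged r (a ` {..<n}) {} \<sigma> (s (Suc m))"
      using step(1) IH(1) Suc.prems by (auto simp: unchanged_def)
    ultimately show ?case by blast
  qed
  from this[of n] show "unchanged r (a ` {..<n}) {} \<sigma> \<sigma>'" and "\<And>i. i < n \<Longrightarrow> scalars \<sigma>' (a i) = v i"
    by (auto simp: s_def \<sigma>'_def)
qed

lemma run_fassign_loop:
  assumes "\<And>i. i < n \<Longrightarrow> fbelow r (f i) \<and> a i < r" "inj_on a {..<n}"
    and "\<And>i \<tau>. i < n \<Longrightarrow> unchanged r {} (a ` {..<n}) \<sigma> \<tau> \<Longrightarrow> fval \<tau> (f i) = v i"
  defines "\<sigma>' \<equiv> run (concat (map (\<lambda>i. fassign r (a i) (f i)) [0..<n])) \<sigma>"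
  shows "unchanged r {} (a ` {..<n}) \<sigma> \<sigma>'" and "\<And>i. i < n \<Longrightarrow> orbitals \<sigma>' (a i) = v i"
proof -
  define s where "s m = run (concat (map (\<lambda>i. fassign r (a i) (f i)) [0..<m])) \<sigma>" for m
  have "unchanged r {} (a ` {..<n}) \<sigma> (s m) \<and> (\<forall>i<m. orbitals (s m) (a i) = v i)" if "m \<le> n" for m
    using that
  proof (induction m)
    case 0
    then show ?case by (simp add: s_def unchanged_def)
  next
    case (Suc m)
    have s: "s (Suc m) = run (fassign r (a m) (f m)) (s m)"
      by (simp add: s_def)
    have IH: "unchanged r {} (a ` {..<n}) \<sigma> (s m)" "\<forall>i<m. orbitals (s m) (a i) = v i"
      using Suc by auto
    have below: "fbelow r (f m)" "a m < r"
      using assms(1)[of m] Suc.prems by auto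
    note step = run_fassign[OF below, of "s m", folded s]
    have "orbitals (s (Suc m)) (a m) = v m"
      using step(2) assms(3)[of m "s m"] IH(1) Suc.prems by simp
    moreover have "a i \<noteq> a m" if "i < m" for i
      using inj_onD[OF assms(2), of i m] that Suc.prems by auto
    moreover have "a i < r" if "i < m" for i
      using assms(1)[of i] that Suc.prems by auto
    ultimately have "\<forall>i<Suc m. orbitals (s (Suc m)) (a i) = v i"
      using step(1) IH(2) by (auto simp: unchanged_def less_Suc_eq)
    moreover have "unchanged r {} (a ` {..<n}) \<sigma> (s (Suc m))"
      using step(1) IH(1) Suc.prems by (auto simp: unchanged_def)
    ultimately show ?case by blast
  qed
  from this[of n] show "unchanged r {} (a ` {..<n}) \<sigma> \<sigma>'" and "\<And>i. i < n \<Longrightarrow> orbitals \<sigma>' (a i) = v i"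
    by (auto simp: s_def \<sigma>'_def)
qed

end

text \<open>The instruction set has no constant functions, so the empty sum is an orbital scaled by
  0.\<close>

primrec fsum :: "(nat \<Rightarrow> fexp) \<Rightarrow> nat \<Rightarrow> fexp" where
  "fsum f 0 = FScale (SConst 0) (FPhi 0)"
| "fsum f (Suc n) = FAdd (fsum f n) (f n)"

lemma feval_fsum: "feval \<phi> \<phi>t \<sigma> (fsum f n) = (\<lambda>x. \<Sum>i<n. feval \<phi> \<phi>t \<sigma> (f i) x)"
  by (induction n) auto

lemma fbelow_fsum: "(\<And>i. i < n \<Longrightarrow> fbelow r (f i)) \<Longrightarrow> fbelow r (fsum f n)"
  by (induction n) auto

lemma length_fsum:
  assumes "\<And>i r. length (fcompile (f i) r) \<le> m"
  shows "length (fcompile (fsum f n) r) \<le> 3 + n * Suc m"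
proof (induction n arbitrary: r)
  case (Suc n)
  from Suc[of r] assms[of n "Suc r"] show ?case by simp
qed simp


text \<open>Layout of the scalar registers: 0 holds the determinant of \<open>E\<close>, 2 the constant \<open>c\<close>; from 3 on
  lie the matrix \<open>E\<close> (before that, its version with first row 0), then \<open>U\<close>, the singular values
  and \<open>V\<close> of the singular value decomposition, and the inverse of \<open>E\<close>.  Function registers: 0 holds
  the result, 2 to 5 hold \<open>\<beta>\<close>, \<open>\<rho>\<close>, its Poisson convolution and \<open>T\<close>, and \<open>6 + i\<close> holds
  \<open>\<theta> i\<close>.  Registers from \<open>r\<close> on are scratch space.\<close>

definition setup_code :: "nat \<Rightarrow> nat \<Rightarrow> instr list" where
  "setup_code N r = concat (map (\<lambda>k. sassign r (3 + k)
     (if k < N then SConst 0 else SInt (FMul (FPhit (k div N)) (FConj (FPhi (k mod N)))))) [0..<N * N])"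

definition svd_code :: "nat \<Rightarrow> instr list" where
  "svd_code N = [Mat_SVD (3 + N * N) (3 + 2 * (N * N)) (3 + 2 * (N * N) + N) 3]"

text \<open>Row-major storage puts the last column of V at the offsets
  \<open>j * N + (N - 1)\<close>. Its conjugate overwrites the zero first row of the overlaps,
  because the first row of E is the conjugate transpose of the null vector.\<close>

definition null_vector_code :: "nat \<Rightarrow> nat \<Rightarrow> instr list" where
  "null_vector_code N r = concat (map (\<lambda>j. sassign r (3 + j)
     (SConj (SReg (3 + 2 * (N * N) + N + j * N + (N - 1))))) [0..<N])"

definition inverse_code :: "nat \<Rightarrow> instr list" where
  "inverse_code N = [Mat_Inverse (3 + 3 * (N * N) + N) 3, Mat_Det 0 3]"

definition theta_code :: "nat \<Rightarrow> nat \<Rightarrow> instr list" where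
  "theta_code N r = concat (map (\<lambda>i. fassign r (6 + i)
     (fsum (\<lambda>k. FScale (SReg (3 + 3 * (N * N) + N + i * N + k)) (FPhit k)) N)) [0..<N])"

text \<open>Subtraction is addition after scaling by -1. The double sum contains N^2 Poisson
  convolutions; the remaining assignments need N + 1 of them together.\<close>

definition final_code :: "nat \<Rightarrow> nat \<Rightarrow> instr list" where
  "final_code N r =
     fassign r 2 (fsum (\<lambda>j. FScale (SReg (3 + 2 * (N * N) + N + j * N + (N - 1))) (FConj (FPhi j))) N) @
     fassign r 3 (fsum (\<lambda>j. FMul (FConj (FPhi j)) (FReg (6 + j))) N) @
     fassign r 4 (FPoisson (FReg 3)) @
     fassign r 5 (FAdd (FMul (FReg 2) (FReg 4)) (FScale (SConst (-1))
       (fsum (\<lambda>j. FMul (FConj (FPhi j)) (FPoisson (FMul (FReg (6 + j)) (FReg 2)))) N))) @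
     sassign r 2 (SInt (FAdd (FMul (FReg 3) (FReg 4)) (FScale (SConst (-1))
       (fsum (\<lambda>i. fsum (\<lambda>j. FMul (FConj (FPhi i))
         (FMul (FPoisson (FMul (FReg (6 + i)) (FConj (FPhi j)))) (FReg (6 + j)))) N) N)))) @
     fassign r 0 (FScale (SMul (SConst (1 / (2 * fact N))) (SReg 0))
       (FAdd (FScale (SConst 2) (FReg 5)) (FAdd (FScale (SReg 2) (FReg 2))
         (FScale (SConst (-2)) (fsum (\<lambda>i. FScale (SInt (FMul (FReg (6 + i)) (FReg 5)))
           (FConj (FPhi i))) N)))))"

text \<open>Four matrices and the singular values end below scalar register 3 + 4 N^2 + N, and the
  stored functions end below register 6 + N. The scratch space starts above both.\<close>

definition formula_code :: "nat \<Rightarrow> instr list" where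
  "formula_code N = (let r = 10 + 4 * (N * N) + N in setup_code N r @ svd_code N @ null_vector_code N r
     @ inverse_code N @ theta_code N r @ final_code N r)"

lemma matrix_index:
  fixes i j N :: nat
  assumes "i < N" "j < N"
  shows "i * N + j < N * N" "(i * N + j) div N = i" "(i * N + j) mod N = j"
proof -
  have "i * N + j < Suc i * N" using assms by simp
  also have "\<dots> \<le> N * N" using assms by (intro mult_right_mono) auto
  finally show "i * N + j < N * N" .
qed (use assms in auto)

lemma scalars_set_mat_inside:
  assumes "i < N" "j < N"
  shows "scalars (set_mat N a A \<sigma>) (a + i * N + j) = A $$ (i, j)"
  using matrix_index[OF assms] by (simp add: set_mat_def add.assoc)

lemma scalars_set_mat_outside:
  "k < a \<or> a + N * N \<le> k \<Longrightarrow> scalars (set_mat N a A \<sigma>) k = scalars \<sigma> k"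
  by (auto simp: set_mat_def)

lemma scalars_set_vec_outside:
  "k < a \<or> a + N \<le> k \<Longrightarrow> scalars (set_vec N a v \<sigma>) k = scalars \<sigma> k"
  by (auto simp: set_vec_def)

text \<open>With its first row set to 0, the matrix of overlaps is singular, and its kernel is the
  orthogonal complement that \<open>d\<close> is taken from.\<close>

definition overlap_mat :: "nat \<Rightarrow> (nat \<Rightarrow> orbital) \<Rightarrow> (nat \<Rightarrow> orbital) \<Rightarrow> complex mat" where
  "overlap_mat N \<phi> \<phi>t = mat N N (\<lambda>(i, j). if i = 0 then 0 else braket (\<phi>t i) (\<phi> j))"

definition svd_null_vector :: "nat \<Rightarrow> (complex mat \<Rightarrow> svd_result) \<Rightarrow> (nat \<Rightarrow> orbital)
    \<Rightarrow> (nat \<Rightarrow> orbital) \<Rightarrow> complex vec" where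
  "svd_null_vector N svd \<phi> \<phi>t =
     (case svd (overlap_mat N \<phi> \<phi>t) of (U, s, V) \<Rightarrow> vec N (\<lambda>j. V $$ (j, N - 1)))"

context machine
begin

text \<open>The output is described with the vector found by the decomposition, because the program
  has no access to a given d. The hypothesis on the inverse provides the shape that reading \<Theta>
  entrywise requires.\<close>

lemma run_formula_code:
  assumes N: "1 \<le> N" and F: "the (mat_inverse (E_mat N \<phi> \<phi>t (svd_null_vector N svd \<phi> \<phi>t))) \<in> carrier_mat N N"
  shows "program_output N svd \<phi> \<phi>t (formula_code N) = closed_formula N \<phi> \<phi>t (svd_null_vector N svd \<phi> \<phi>t)"
proof -
  define d where "d = svd_null_vector N svd \<phi> \<phi>t"
  define E where "E = E_mat N \<phi> \<phi>t d"
  define r where "r = 10 + 4 * (N * N) + N"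
  define \<sigma>1 where "\<sigma>1 = run (setup_code N r) initial_state"
  define \<sigma>2 where "\<sigma>2 = run (svd_code N) \<sigma>1"
  define \<sigma>3 where "\<sigma>3 = run (null_vector_code N r) \<sigma>2"
  define \<sigma>4 where "\<sigma>4 = run (inverse_code N) \<sigma>3"
  define \<sigma>5 where "\<sigma>5 = run (theta_code N r) \<sigma>4"
  define \<sigma>6 where "\<sigma>6 = run (final_code N r) \<sigma>5"
  let ?v = "3 + 2 * (N * N) + N"
  let ?F = "the (mat_inverse E)"
  let ?w = "3 + 3 * (N * N) + N"
  have result: "program_output N svd \<phi> \<phi>t (formula_code N) = orbitals \<sigma>6 0"
    by (simp add: program_output_def formula_code_def Let_def \<sigma>1_def \<sigma>2_def \<sigma>3_def \<sigma>4_def \<sigma>5_def \<sigma>6_def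
        flip: r_def)
  interpret theta_setting N \<phi> \<phi>t d
    using F by unfold_locales (auto simp: d_def svd_null_vector_def split: prod.splits)
  have idx: "i * N + j < N * N" if "i < N" "j < N" for i j
    by (rule matrix_index[OF that])
  have last: "i * N + (N - 1) < N * N" if "i < N" for i
    using idx[of i "N - 1"] that N by simp

  have \<sigma>1: "scalars \<sigma>1 (3 + k) = (if k < N then 0 else braket (\<phi>t (k div N)) (\<phi> (k mod N)))"
    if "k < N * N" for k
    unfolding \<sigma>1_def setup_code_def
    by (rule run_sassign_loop(2)[OF _ _ _ that]) (auto simp: r_def inj_on_def braket_def)
  have A: "get_mat N 3 \<sigma>1 = overlap_mat N \<phi> \<phi>t"
  proof (rule eq_matI)
    fix i j assume "i < dim_row (overlap_mat N \<phi> \<phi>t)" "j < dim_col (overlap_mat N \<phi> \<phi>t)"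
    then have ij: "i < N" "j < N" by (auto simp: overlap_mat_def)
    have "i = 0 \<longleftrightarrow> i * N + j < N" using ij by (cases i) auto
    then show "get_mat N 3 \<sigma>1 $$ (i, j) = overlap_mat N \<phi> \<phi>t $$ (i, j)"
      using ij \<sigma>1[OF matrix_index(1)[OF ij]] matrix_index(2,3)[OF ij]
      by (auto simp: get_mat_def overlap_mat_def add.assoc)
  qed (auto simp: get_mat_def overlap_mat_def)

  obtain U s V where svd: "svd (overlap_mat N \<phi> \<phi>t) = (U, s, V)"
    by (cases "svd (overlap_mat N \<phi> \<phi>t)")
  have d: "d $ j = V $$ (j, N - 1)" if "j < N" for j
    using that by (simp add: d_def svd_null_vector_def svd)
  have \<sigma>2: "\<sigma>2 = set_mat N ?v V (set_vec N (3 + 2 * (N * N)) s (set_mat N (3 + N * N) U \<sigma>1))"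
    by (simp add: \<sigma>2_def svd_code_def A svd)
  have V2: "scalars \<sigma>2 (?v + j * N + (N - 1)) = d $ j" if "j < N" for j
    using that N unfolding \<sigma>2 by (subst scalars_set_mat_inside) (auto simp: d)
  have E2: "scalars \<sigma>2 (3 + k) = scalars \<sigma>1 (3 + k)" if "k < N * N" for k
    using that unfolding \<sigma>2
    by (simp add: scalars_set_mat_outside scalars_set_vec_outside)

  have loop3: "unchanged r ((\<lambda>j. 3 + j) ` {..<N}) {} \<sigma>2 \<sigma>3"
      "\<And>j. j < N \<Longrightarrow> scalars \<sigma>3 (3 + j) = cnj (d $ j)"
  proof -
    let ?e = "\<lambda>j. SConj (SReg (?v + j * N + (N - 1)))"
    have below: "sbelow r (?e i) \<and> 3 + i < r" if "i < N" for i
      using last[OF that] that by (auto simp: r_def)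
    have inj: "inj_on (\<lambda>j. 3 + j) {..<N}" by (simp add: inj_on_def)
    have val: "sval \<tau> (?e i) = cnj (d $ i)"
      if i: "i < N" and \<tau>: "unchanged r ((\<lambda>j. 3 + j) ` {..<N}) {} \<sigma>2 \<tau>" for i \<tau>
    proof -
      have "?v + i * N + (N - 1) < r" using last[OF i] by (auto simp: r_def)
      moreover have "?v + i * N + (N - 1) \<notin> (\<lambda>j. 3 + j) ` {..<N}" by auto
      ultimately show ?thesis
        using unchanged_scalar[OF \<tau>] V2[OF i] by simp
    qed
    note loop = run_sassign_loop[of N r ?e "\<lambda>j. 3 + j" \<sigma>2 "\<lambda>j. cnj (d $ j)", OF below inj val,
        folded null_vector_code_def \<sigma>3_def]
    from loop(1) show "unchanged r ((\<lambda>j. 3 + j) ` {..<N}) {} \<sigma>2 \<sigma>3" .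
    from loop(2) show "\<And>j. j < N \<Longrightarrow> scalars \<sigma>3 (3 + j) = cnj (d $ j)" .
  qed
  have V3: "scalars \<sigma>3 (?v + j * N + (N - 1)) = d $ j" if "j < N" for j
  proof -
    have "?v + j * N + (N - 1) \<notin> (\<lambda>j. 3 + j) ` {..<N}" by auto
    moreover have "?v + j * N + (N - 1) < r" using last[OF that] by (auto simp: r_def)
    ultimately show ?thesis
      using unchanged_scalar[OF loop3(1)] V2[OF that] by simp
  qed
  have E3: "get_mat N 3 \<sigma>3 = E"
  proof (rule eq_matI)
    fix i j assume "i < dim_row E" "j < dim_col E"
    then have ij: "i < N" "j < N" by (auto simp: E_def E_mat_def)
    show "get_mat N 3 \<sigma>3 $$ (i, j) = E $$ (i, j)"
    proof (cases "i = 0")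
      case True
      then show ?thesis using ij loop3(2)[of j] by (simp add: get_mat_def E_def E_mat_def)
    next
      case False
      then have "N \<le> i * N" by simp
      then have "\<not> i * N + j < N" by linarith
      moreover from this have "scalars \<sigma>3 (3 + (i * N + j)) = scalars \<sigma>2 (3 + (i * N + j))"
        using idx[OF ij] by (intro unchanged_scalar[OF loop3(1)]) (auto simp: r_def)
      ultimately show ?thesis
        using False ij E2[OF idx[OF ij]] \<sigma>1[OF idx[OF ij]] matrix_index(2,3)[OF ij]
        by (simp add: get_mat_def E_def E_mat_def add.assoc)
    qed
  qed (auto simp: get_mat_def E_def E_mat_def)

  have \<sigma>4: "\<sigma>4 = set_scalar 0 (Determinant.det (get_mat N 3 (set_mat N ?w ?F \<sigma>3))) (set_mat N ?w ?F \<sigma>3)"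
    by (simp add: \<sigma>4_def inverse_code_def E3)
  \<comment> \<open>The inverse is stored beyond E, so the determinant computed afterwards is still
    that of E.\<close>
  have "get_mat N 3 (set_mat N ?w ?F \<sigma>3) = get_mat N 3 \<sigma>3"
  proof (rule eq_matI)
    fix i j assume "i < dim_row (get_mat N 3 \<sigma>3)" "j < dim_col (get_mat N 3 \<sigma>3)"
    then have ij: "i < N" "j < N" by (auto simp: get_mat_def)
    have "3 + i * N + j < ?w" using idx[OF ij] by simp
    then have "scalars (set_mat N ?w ?F \<sigma>3) (3 + i * N + j) = scalars \<sigma>3 (3 + i * N + j)"
      by (intro scalars_set_mat_outside disjI1)
    with ij show "get_mat N 3 (set_mat N ?w ?F \<sigma>3) $$ (i, j) = get_mat N 3 \<sigma>3 $$ (i, j)"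
      by (simp add: get_mat_def)
  qed (auto simp: get_mat_def)
  then have det4: "scalars \<sigma>4 0 = Determinant.det E"
    by (simp add: \<sigma>4 E3)
  have F4: "scalars \<sigma>4 (?w + i * N + j) = F i j" if "i < N" "j < N" for i j
    using scalars_set_mat_inside[OF that, of ?w ?F \<sigma>3] by (simp add: \<sigma>4 F_def E_def)
  have V4: "scalars \<sigma>4 (?v + j * N + (N - 1)) = d $ j" if "j < N" for j
    using last[OF that] V3[OF that] by (simp add: \<sigma>4 scalars_set_mat_outside)

  have loop5: "unchanged r {} ((\<lambda>i. 6 + i) ` {..<N}) \<sigma>4 \<sigma>5"
      "\<And>i. i < N \<Longrightarrow> orbitals \<sigma>5 (6 + i) = \<theta> i"
  proof -
    let ?f = "\<lambda>i. fsum (\<lambda>k. FScale (SReg (?w + i * N + k)) (FPhit k)) N"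
    have below: "fbelow r (?f i) \<and> 6 + i < r" if "i < N" for i
    proof
      show "fbelow r (?f i)"
      proof (rule fbelow_fsum)
        fix k assume "k < N"
        then show "fbelow r (FScale (SReg (?w + i * N + k)) (FPhit k))"
          using idx[OF that, of k] by (simp add: r_def)
      qed
    qed (use that in \<open>simp add: r_def\<close>)
    have inj: "inj_on (\<lambda>j. 6 + j) {..<N}" by (simp add: inj_on_def)
    have val: "fval \<tau> (?f i) = \<theta> i"
      if i: "i < N" and \<tau>: "unchanged r {} ((\<lambda>i. 6 + i) ` {..<N}) \<sigma>4 \<tau>" for i \<tau>
    proof -
      have "scalars \<tau> (?w + i * N + k) = F i k" if "k < N" for k
        using unchanged_scalar[OF \<tau>, of "?w + i * N + k"] F4[OF i that] idx[OF i that]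
        by (simp add: r_def)
      then show ?thesis by (simp add: feval_fsum fun_eq_iff \<theta>_def)
    qed
    note loop = run_fassign_loop[of N r ?f "\<lambda>i. 6 + i" \<sigma>4 \<theta>, OF below inj val,
        folded theta_code_def \<sigma>5_def]
    from loop(1) show "unchanged r {} ((\<lambda>i. 6 + i) ` {..<N}) \<sigma>4 \<sigma>5" .
    from loop(2) show "\<And>i. i < N \<Longrightarrow> orbitals \<sigma>5 (6 + i) = \<theta> i" .
  qed
  have det5: "scalars \<sigma>5 0 = Determinant.det E"
    using unchanged_scalar[OF loop5(1), of 0] det4 by (simp add: r_def)
  have V5: "scalars \<sigma>5 (?v + j * N + (N - 1)) = d $ j" if "j < N" for j
    using unchanged_scalar[OF loop5(1), of "?v + j * N + (N - 1)"] V4[OF that] last[OF that]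
    by (simp add: r_def)

  have small: "6 + i < r" if "i < N" for i using that by (simp add: r_def)
  have small0: "0 < r" "2 < r" "3 < r" "4 < r" "5 < r" by (simp_all add: r_def)
  define \<tau>1 where "\<tau>1 = run (fassign r 2 (fsum (\<lambda>j. FScale (SReg (?v + j * N + (N - 1))) (FConj (FPhi j))) N)) \<sigma>5"
  have 1: "unchanged r {} {2} \<sigma>5 \<tau>1" "orbitals \<tau>1 2 = \<beta>"
  proof -
    have below: "fbelow r (fsum (\<lambda>j. FScale (SReg (?v + j * N + (N - 1))) (FConj (FPhi j))) N)"
    proof (rule fbelow_fsum)
      fix j assume "j < N"
      then show "fbelow r (FScale (SReg (?v + j * N + (N - 1))) (FConj (FPhi j)))"
        using last[of j] by (simp add: r_def)
    qed
    note step = run_fassign[OF below small0(2), of \<sigma>5, folded \<tau>1_def]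
    from step(1) show "unchanged r {} {2} \<sigma>5 \<tau>1" .
    have "(\<Sum>j<N. scalars \<sigma>5 (?v + j * N + (N - 1)) * cnj (\<phi> j x)) = \<beta> x" for x
      unfolding \<beta>_def by (intro sum.cong refl) (metis V5 lessThan_iff mult.commute)
    then show "orbitals \<tau>1 2 = \<beta>"
      by (simp only: step(2) feval_fsum seval.simps feval.simps)
  qed
  have \<theta>1: "orbitals \<tau>1 (6 + i) = \<theta> i" if "i < N" for i
    using unchanged_orbital[OF 1(1) small[OF that]] loop5(2)[OF that] by simp
  define \<tau>2 where "\<tau>2 = run (fassign r 3 (fsum (\<lambda>j. FMul (FConj (FPhi j)) (FReg (6 + j))) N)) \<tau>1"
  have 2: "unchanged r {} {3} \<tau>1 \<tau>2" "orbitals \<tau>2 3 = \<rho>"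
  proof -
    have below: "fbelow r (fsum (\<lambda>j. FMul (FConj (FPhi j)) (FReg (6 + j))) N)"
      using small by (intro fbelow_fsum) auto
    note step = run_fassign[OF below small0(3), of \<tau>1, folded \<tau>2_def]
    from step(1) show "unchanged r {} {3} \<tau>1 \<tau>2" .
    from step(2) show "orbitals \<tau>2 3 = \<rho>"
      by (auto simp: feval_fsum fun_eq_iff \<rho>_def \<theta>1 intro!: sum.cong)
  qed
  define \<tau>3 where "\<tau>3 = run (fassign r 4 (FPoisson (FReg 3))) \<tau>2"
  have 3: "unchanged r {} {4} \<tau>2 \<tau>3" "orbitals \<tau>3 4 = poisson \<rho>"
    using run_fassign[of r "FPoisson (FReg 3)" 4 \<tau>2, folded \<tau>3_def] small0 2(2) by auto
  have \<theta>3: "orbitals \<tau>3 (6 + i) = \<theta> i" if "i < N" for i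
    using unchanged_orbital[OF 3(1) small[OF that]] unchanged_orbital[OF 2(1) small[OF that]] \<theta>1[OF that]
    by simp
  have old3: "orbitals \<tau>3 2 = \<beta>" "orbitals \<tau>3 3 = \<rho>"
    using unchanged_orbital[OF 3(1), of 2] unchanged_orbital[OF 2(1), of 2] 1(2)
      unchanged_orbital[OF 3(1), of 3] 2(2) small0 by simp_all
  let ?T = "FAdd (FMul (FReg 2) (FReg 4)) (FScale (SConst (-1))
       (fsum (\<lambda>j. FMul (FConj (FPhi j)) (FPoisson (FMul (FReg (6 + j)) (FReg 2)))) N))"
  define \<tau>4 where "\<tau>4 = run (fassign r 5 ?T) \<tau>3"
  have 4: "unchanged r {} {5} \<tau>3 \<tau>4" "orbitals \<tau>4 5 = T"
  proof -
    have below: "fbelow r ?T"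
      using small small0 by (auto intro!: fbelow_fsum)
    note step = run_fassign[OF below small0(5), of \<tau>3, folded \<tau>4_def]
    from step(1) show "unchanged r {} {5} \<tau>3 \<tau>4" .
    have "(\<Sum>j<N. cnj (\<phi> j x) * poisson (\<lambda>x. orbitals \<tau>3 (6 + j) x * \<beta> x) x)
        = (\<Sum>j<N. cnj (\<phi> j x) * poisson (\<lambda>y. \<theta> j y * \<beta> y) x)" for x
      by (intro sum.cong) (auto simp: \<theta>3)
    with step(2) show "orbitals \<tau>4 5 = T"
      by (simp add: feval_fsum old3 3(2) fun_eq_iff T_def)
  qed
  have old4: "orbitals \<tau>4 2 = \<beta>" "orbitals \<tau>4 3 = \<rho>" "orbitals \<tau>4 4 = poisson \<rho>"
    using unchanged_orbital[OF 4(1), of 2] unchanged_orbital[OF 4(1), of 3]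
      unchanged_orbital[OF 4(1), of 4] old3 3(2) small0 by simp_all
  have \<theta>4: "orbitals \<tau>4 (6 + i) = \<theta> i" if "i < N" for i
    using unchanged_orbital[OF 4(1) small[OF that]] \<theta>3[OF that] by simp
  let ?c = "SInt (FAdd (FMul (FReg 3) (FReg 4)) (FScale (SConst (-1))
       (fsum (\<lambda>i. fsum (\<lambda>j. FMul (FConj (FPhi i))
         (FMul (FPoisson (FMul (FReg (6 + i)) (FConj (FPhi j)))) (FReg (6 + j)))) N) N)))"
  define \<tau>5 where "\<tau>5 = run (sassign r 2 ?c) \<tau>4"
  have 5: "unchanged r {2} {} \<tau>4 \<tau>5" "scalars \<tau>5 2 = c"
  proof -
    have below: "sbelow r ?c"
      using small small0 by (auto intro!: fbelow_fsum)
    note step = run_sassign[OF below small0(2), of \<tau>4, folded \<tau>5_def]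
    from step(1) show "unchanged r {2} {} \<tau>4 \<tau>5" .
    have "(\<Sum>i<N. \<Sum>j<N. cnj (\<phi> i x) *
          (poisson (\<lambda>x. orbitals \<tau>4 (6 + i) x * cnj (\<phi> j x)) x * orbitals \<tau>4 (6 + j) x))
        = (\<Sum>i<N. \<Sum>j<N. cnj (\<phi> i x) * (poisson (\<lambda>y. \<theta> i y * cnj (\<phi> j y)) x * \<theta> j x))" for x
      by (intro sum.cong) (auto simp: \<theta>4)
    with step(2) show "scalars \<tau>5 2 = c"
      by (simp add: feval_fsum old4 c_def)
  qed
  have old5: "orbitals \<tau>5 2 = \<beta>" "orbitals \<tau>5 5 = T"
    using unchanged_orbital[OF 5(1), of 2] unchanged_orbital[OF 5(1), of 5] old4 4(2) small0 by simp_all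
  have \<theta>5: "orbitals \<tau>5 (6 + i) = \<theta> i" if "i < N" for i
    using unchanged_orbital[OF 5(1) small[OF that]] \<theta>4[OF that] by simp
  have det6: "scalars \<tau>5 0 = Determinant.det E"
    using unchanged_scalar[OF 5(1), of 0] unchanged_scalar[OF 4(1), of 0] unchanged_scalar[OF 3(1), of 0]
      unchanged_scalar[OF 2(1), of 0] unchanged_scalar[OF 1(1), of 0] det5 small0 by simp
  let ?out = "FScale (SMul (SConst (1 / (2 * fact N))) (SReg 0))
       (FAdd (FScale (SConst 2) (FReg 5)) (FAdd (FScale (SReg 2) (FReg 2))
         (FScale (SConst (-2)) (fsum (\<lambda>i. FScale (SInt (FMul (FReg (6 + i)) (FReg 5)))
           (FConj (FPhi i))) N))))"
  have \<sigma>6: "\<sigma>6 = run (fassign r 0 ?out) \<tau>5"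
    by (simp add: \<sigma>6_def final_code_def \<tau>1_def \<tau>2_def \<tau>3_def \<tau>4_def \<tau>5_def)
  have below: "fbelow r ?out"
    using small small0 by (auto intro!: fbelow_fsum)
  have "orbitals \<sigma>6 0 = closed_formula N \<phi> \<phi>t d"
  proof
    fix \<gamma>
    have "(\<Sum>i<N. (\<integral>x. orbitals \<tau>5 (6 + i) x * T x \<partial>particle_measure) * cnj (\<phi> i \<gamma>))
        = (\<Sum>i<N. H i * cnj (\<phi> i \<gamma>))"
      by (intro sum.cong refl) (simp add: \<theta>5 H_def)
    then show "orbitals \<sigma>6 0 \<gamma> = closed_formula N \<phi> \<phi>t d \<gamma>"
      using run_fassign(2)[OF below small0(1), of \<tau>5, folded \<sigma>6]
      by (simp add: feval_fsum old5 det6 5(2) closed_formula_scalar E_def)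
  qed
  then show ?thesis
    by (simp add: result d_def)
qed

end

subsection \<open>Null vectors from the singular value decomposition\<close>

lemma invertible_mat_iff_det:
  fixes A :: "complex mat"
  assumes A: "A \<in> carrier_mat n n"
  shows "invertible_mat A \<longleftrightarrow> Determinant.det A \<noteq> 0"
proof
  assume "invertible_mat A"
  then obtain B where B: "A * B = 1\<^sub>m n" "B * A = 1\<^sub>m (dim_row B)"
    using A by (auto simp: invertible_mat_def inverts_mat_def)
  have "dim_col B = n" using arg_cong[OF B(1), of dim_col] by simp
  moreover have "dim_row B = n" using arg_cong[OF B(2), of dim_col] A by simp
  ultimately have "B \<in> carrier_mat n n" by (intro carrier_matI)
  from det_mult[OF A this] have "Determinant.det A * Determinant.det B = 1"
    by (simp only: B(1) det_one)
  then show "Determinant.det A \<noteq> 0" by auto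
next
  assume "Determinant.det A \<noteq> 0"
  then have "A \<in> Units (ring_mat TYPE(complex) n ())"
    by (rule det_non_zero_imp_unit[OF A])
  then obtain B where "mat_inverse A = Some B"
    using mat_inverse(1)[OF A, of "()"] by (cases "mat_inverse A") auto
  then show "invertible_mat A"
    using mat_inverse(2)[OF A] A by (auto simp: invertible_mat_def inverts_mat_def)
qed

lemma mat_inverse_of_invertible:
  fixes A :: "complex mat"
  assumes A: "A \<in> carrier_mat n n" and "invertible_mat A"
  shows "the (mat_inverse A) \<in> carrier_mat n n" "the (mat_inverse A) * A = 1\<^sub>m n"
proof -
  have "A \<in> Units (ring_mat TYPE(complex) n ())"
    by (rule det_non_zero_imp_unit[OF A]) (use assms invertible_mat_iff_det[OF A] in simp)
  then obtain B where "mat_inverse A = Some B"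
    using mat_inverse(1)[OF A, of "()"] by (cases "mat_inverse A") auto
  then show "the (mat_inverse A) \<in> carrier_mat n n" "the (mat_inverse A) * A = 1\<^sub>m n"
    using mat_inverse(2)[OF A] by auto
qed

lemma E_mat_carrier [simp]: "E_mat N \<phi> \<phi>t d \<in> carrier_mat N N"
  by (simp add: E_mat_def)

lemma overlap_mat_carrier [simp]: "overlap_mat N \<phi> \<phi>t \<in> carrier_mat N N"
  by (simp add: overlap_mat_def)

lemma det_overlap_mat:
  assumes "1 \<le> N"
  shows "Determinant.det (overlap_mat N \<phi> \<phi>t) = 0"
proof -
  have "(\<Prod>i = 0..<N. overlap_mat N \<phi> \<phi>t $$ (i, p i)) = 0" if "p permutes {0..<N}" for p
    using assms permutes_in_image[OF that, of 0]
    by (intro prod_zero) (auto simp: overlap_mat_def intro!: bexI[of _ 0])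
  then show ?thesis
    unfolding det_def'[OF overlap_mat_carrier] by (intro sum.neutral ballI) simp
qed

text \<open>Singularity forces some singular value to vanish, and by the decreasing order the last
  one does. The adjoint of V inverts V, so it sends the last column of V to the last unit vector,
  which the diagonal factor annihilates. The same relation gives the norm 1.\<close>

lemma svd_last_column:
  assumes svd: "is_svd N A (U, s, V)" and A: "A \<in> carrier_mat N N"
    and det: "Determinant.det A = 0" and N: "1 \<le> N"
  defines "v \<equiv> col V (N - 1)"
  shows "A *\<^sub>v v = 0\<^sub>v N" "v \<bullet>* v = 1"
proof -
  define D :: "complex mat" where "D = mat N N (\<lambda>(i, j). if i = j then of_real (s $ i) else 0)"
  define W where "W = mat_adjoint V"
  have U: "U \<in> carrier_mat N N" "mat_adjoint U * U = 1\<^sub>m N"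
    and V: "V \<in> carrier_mat N N" "W * V = 1\<^sub>m N"
    and s: "\<And>i. i < N \<Longrightarrow> 0 \<le> s $ i" "\<And>i j. i \<le> j \<Longrightarrow> j < N \<Longrightarrow> s $ j \<le> s $ i"
    and eq: "A = U * D * W"
    using svd by (auto simp: is_svd_def D_def W_def)
  have adj: "mat_adjoint B \<in> carrier_mat N N" if "B \<in> carrier_mat N N" for B :: "complex mat"
    using that by (auto simp: mat_adjoint_def mat_of_rows_def)
  have W: "W \<in> carrier_mat N N" and D: "D \<in> carrier_mat N N"
    using adj[OF V(1)] by (simp_all add: W_def D_def)
  have v: "v \<in> carrier_vec N" using V(1) N by (auto simp: v_def)
  have "Determinant.det U \<noteq> 0"
    using det_mult[OF adj[OF U(1)] U(1)] U(2) by auto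
  moreover have "Determinant.det W \<noteq> 0"
    using det_mult[OF W V(1)] V(2) by auto
  moreover have "Determinant.det A = Determinant.det U * Determinant.det D * Determinant.det W"
    unfolding eq using U(1) D W by (simp add: det_mult[of _ N])
  ultimately have "Determinant.det D = 0" using det by simp
  moreover have "Determinant.det D = prod_list (diag_mat D)"
    by (intro det_upper_triangular[OF _ D]) (auto simp: upper_triangular_def D_def)
  ultimately obtain i where "i < N" "s $ i = 0"
    by (auto simp: prod_list_zero_iff diag_mat_def D_def)
  then have s0: "s $ (N - 1) = 0"
    using s(1)[of "N - 1"] s(2)[of i "N - 1"] N by simp
  have "W *\<^sub>v v = col (W * V) (N - 1)"
    using W V(1) N by (intro eq_vecI) (auto simp: v_def)
  also have "\<dots> = unit_vec N (N - 1)"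
    using V(2) N by simp
  finally have Wv: "W *\<^sub>v v = unit_vec N (N - 1)" .
  have "D *\<^sub>v unit_vec N (N - 1) = 0\<^sub>v N"
    using N s0 by (intro eq_vecI) (auto simp: D_def scalar_prod_right_unit)
  then have "U *\<^sub>v (D *\<^sub>v (W *\<^sub>v v)) = 0\<^sub>v N"
    using U(1) by (auto simp: Wv)
  then show "A *\<^sub>v v = 0\<^sub>v N"
    unfolding eq using U(1) D W v by (simp add: assoc_mult_mat_vec[of _ N N _ N])
  have "W $$ (N - 1, k) = cnj (v $ k)" if "k < N" for k
    using that N V(1) by (simp add: W_def v_def mat_adjoint_def mat_of_rows_def)
  then have "row W (N - 1) = conjugate v"
    using W v N by (intro eq_vecI) auto
  moreover have "(W * V) $$ (N - 1, N - 1) = row W (N - 1) \<bullet> v"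
    using W V(1) N by (simp add: v_def)
  ultimately show "v \<bullet>* v = 1"
    using V(2) N by simp
qed

text \<open>For v = d this says E d = e_0, so d is the first column of the inverse; for another null
  vector v it shows that E v is a multiple of E d.\<close>

lemma E_mat_mult_null_vector:
  assumes "unit_null_vector N \<phi> \<phi>t d" "v \<in> carrier_vec N" "overlap_mat N \<phi> \<phi>t *\<^sub>v v = 0\<^sub>v N" "1 \<le> N"
  shows "E_mat N \<phi> \<phi>t d *\<^sub>v v = (d \<bullet>* v) \<cdot>\<^sub>v unit_vec N 0"
proof (rule eq_vecI)
  fix i assume "i < dim_vec ((d \<bullet>* v) \<cdot>\<^sub>v unit_vec N 0)"
  then have i: "i < N" by simp
  have d: "d \<in> carrier_vec N" using assms(1) by (simp add: unit_null_vector_def)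
  show "(E_mat N \<phi> \<phi>t d *\<^sub>v v) $ i = ((d \<bullet>* v) \<cdot>\<^sub>v unit_vec N 0) $ i"
  proof (cases "i = 0")
    case True
    then show ?thesis
      using i d assms(2) by (auto simp: E_mat_def scalar_prod_def)
  next
    case False
    have "(E_mat N \<phi> \<phi>t d *\<^sub>v v) $ i = (overlap_mat N \<phi> \<phi>t *\<^sub>v v) $ i"
      using i False assms(2) by (simp add: E_mat_def overlap_mat_def scalar_prod_def)
    then show ?thesis using i False assms(3) by simp
  qed
qed (simp add: E_mat_def)

lemma overlap_mat_null_vector:
  assumes "v \<in> carrier_vec N"
  shows "overlap_mat N \<phi> \<phi>t *\<^sub>v v = 0\<^sub>v N \<longleftrightarrow>
    (\<forall>i\<in>{1..<N}. (\<Sum>j<N. braket (\<phi>t i) (\<phi> j) * v $ j) = 0)"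
proof -
  have "(overlap_mat N \<phi> \<phi>t *\<^sub>v v) $ i =
      (if i = 0 then 0 else \<Sum>j<N. braket (\<phi>t i) (\<phi> j) * v $ j)" if "i < N" for i
    using that assms by (simp add: overlap_mat_def scalar_prod_def atLeast0LessThan)
  then show ?thesis
    by (auto simp: vec_eq_iff overlap_mat_def)
qed

text \<open>The unit vector is determined up to a phase, and the closed formula does not depend on the phase
  because it equals the inner product.  Hence the program may use the vector found by the
  singular value decomposition in place of \<open>d\<close>.\<close>

lemma nonsingular_setting_svd:
  assumes "nonsingular_setting N \<phi> \<phi>t d" "svd_routine N svd"
  shows "nonsingular_setting N \<phi> \<phi>t (svd_null_vector N svd \<phi> \<phi>t)"
proof -
  have N: "1 \<le> N" and null: "unit_null_vector N \<phi> \<phi>t d" and inv: "invertible_mat (E_mat N \<phi> \<phi>t d)"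
    using assms(1) by (auto simp: nonsingular_setting_def)
  have d: "d \<in> carrier_vec N" "d \<bullet>* d = 1" "overlap_mat N \<phi> \<phi>t *\<^sub>v d = 0\<^sub>v N"
    using null overlap_mat_null_vector by (auto simp: unit_null_vector_def)
  define v where "v = svd_null_vector N svd \<phi> \<phi>t"
  obtain U s V where svd: "svd (overlap_mat N \<phi> \<phi>t) = (U, s, V)"
    by (cases "svd (overlap_mat N \<phi> \<phi>t)")
  then have is_svd: "is_svd N (overlap_mat N \<phi> \<phi>t) (U, s, V)"
    using assms(2) overlap_mat_carrier unfolding svd_routine_def by metis
  then have "V \<in> carrier_mat N N" by (simp add: is_svd_def)
  then have v_col: "v = col V (N - 1)"
    by (auto simp: v_def svd_null_vector_def svd col_def)
  have v: "v \<in> carrier_vec N" "overlap_mat N \<phi> \<phi>t *\<^sub>v v = 0\<^sub>v N" "v \<bullet>* v = 1"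
    using svd_last_column[OF is_svd overlap_mat_carrier det_overlap_mat[OF N] N]
    by (simp_all only: v_col[symmetric]) (simp add: v_def svd_null_vector_def split: prod.split)
  define F where "F = the (mat_inverse (E_mat N \<phi> \<phi>t d))"
  have F: "F \<in> carrier_mat N N" "F * E_mat N \<phi> \<phi>t d = 1\<^sub>m N"
    using mat_inverse_of_invertible[OF E_mat_carrier inv] by (auto simp: F_def)
  have F_E: "F *\<^sub>v (E_mat N \<phi> \<phi>t d *\<^sub>v u) = u" if "u \<in> carrier_vec N" for u
    using assoc_mult_mat_vec[OF F(1) E_mat_carrier that, of \<phi> \<phi>t d] F(2) that by simp
  define c where "c = d \<bullet>* v"
  \<comment> \<open>Under the nonsingular E, both vectors are preimages of multiples of the first
    unit vector, hence proportional.\<close>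
  have "d = F *\<^sub>v unit_vec N 0"
    using F_E[OF d(1)] E_mat_mult_null_vector[OF null d(1,3) N] d(2) by simp
  moreover have "v = F *\<^sub>v (c \<cdot>\<^sub>v unit_vec N 0)"
    using F_E[OF v(1)] E_mat_mult_null_vector[OF null v(1,2) N] by (simp add: c_def)
  ultimately have vd: "v = c \<cdot>\<^sub>v d"
    using F(1) by (simp add: mult_mat_vec[OF F(1)])
  have "c \<noteq> 0" using v(3) vd d(1) by auto
  \<comment> \<open>Only the first row of E depends on the vector, so passing from d to c d
    multiplies the determinant by the conjugate of c, which is nonzero.\<close>
  have "E_mat N \<phi> \<phi>t v = multrow 0 (cnj c) (E_mat N \<phi> \<phi>t d)"
    using d(1) by (intro eq_matI) (auto simp: E_mat_def vd)
  then have "Determinant.det (E_mat N \<phi> \<phi>t v) = cnj c * Determinant.det (E_mat N \<phi> \<phi>t d)"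
    using N det_multrow[OF _ E_mat_carrier, of 0 N "cnj c"] by simp
  then have "invertible_mat (E_mat N \<phi> \<phi>t v)"
    using inv \<open>c \<noteq> 0\<close> by (simp add: invertible_mat_iff_det[OF E_mat_carrier])
  then show ?thesis
    using assms(1) v overlap_mat_null_vector[OF v(1)]
    by (auto simp: nonsingular_setting_def unit_null_vector_def simp flip: v_def)
qed

subsection \<open>Cost\<close>

text \<open>One crude bound for all instructions except the dense matrix routines suffices: there
  are O(N^2) of them, and the Poisson convolution is allowed the largest cost. Absolute values
  appear because the cost functions are only bounded asymptotically and may have any sign.\<close>

definition elementary :: "instr \<Rightarrow> bool" where
  "elementary i \<longleftrightarrow> (\<forall>cS cF cW cL N M. instr_cost cS cF cW cL N M i \<le> \<bar>cS\<bar> + \<bar>cF M\<bar> + \<bar>cW M\<bar>)"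

lemma elementary_compile:
  "list_all elementary (scompile e r)" "list_all elementary (fcompile f r)"
  by (induction e and f arbitrary: r and r) (auto simp: elementary_def)

lemma elementary_assign: "list_all elementary (sassign r a e)" "list_all elementary (fassign r a f)"
  by (auto simp: sassign_def fassign_def elementary_compile) (auto simp: elementary_def)

lemma program_cost_append:
  "program_cost cS cF cW cL N M (p @ q) = program_cost cS cF cW cL N M p + program_cost cS cF cW cL N M q"
  by (simp add: program_cost_def)

lemma program_cost_elementary:
  "list_all elementary p \<Longrightarrow>
    program_cost cS cF cW cL N M p \<le> real (length p) * (\<bar>cS\<bar> + \<bar>cF M\<bar> + \<bar>cW M\<bar>)"
proof (induction p)
  case (Cons i p)
  then have "instr_cost cS cF cW cL N M i \<le> \<bar>cS\<bar> + \<bar>cF M\<bar> + \<bar>cW M\<bar>"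
    by (auto simp: elementary_def)
  with Cons show ?case by (simp add: program_cost_def algebra_simps)
qed (simp add: program_cost_def)

lemma length_concat_le:
  "(\<And>i. length (f i) \<le> m) \<Longrightarrow> length (concat (map f [0..<n])) \<le> n * m"
proof (induction n)
  case (Suc n)
  from Suc.IH[OF Suc.prems] Suc.prems[of n] show ?case by simp
qed simp

lemma list_all_concat: "(\<And>i. list_all P (f i)) \<Longrightarrow> list_all P (concat (map f [0..<n]))"
  by (induction n) auto

lemma length_setup_code: "length (setup_code N r) \<le> 8 * (N * N)"
proof -
  have "length (setup_code N r) \<le> N * N * 8"
    unfolding setup_code_def by (rule length_concat_le) (simp add: sassign_def)
  then show ?thesis by simp
qed

lemma length_null_vector_code: "length (null_vector_code N r) \<le> 8 * N"
proof -
  have "length (null_vector_code N r) \<le> N * 8"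
    unfolding null_vector_code_def by (rule length_concat_le) (simp add: sassign_def)
  then show ?thesis by simp
qed

lemma length_theta_code: "length (theta_code N r) \<le> 5 * N + 5 * (N * N)"
proof -
  have "length (theta_code N r) \<le> N * (5 + N * 5)"
    unfolding theta_code_def
  proof (rule length_concat_le)
    fix i
    show "length (fassign r (6 + i) (fsum (\<lambda>k. FScale (SReg (3 + 3 * (N * N) + N + i * N + k)) (FPhit k)) N))
        \<le> 5 + N * 5"
      using length_fsum[of "\<lambda>k. FScale (SReg (3 + 3 * (N * N) + N + i * N + k)) (FPhit k)" 4 N r]
      by (simp add: fassign_def)
  qed
  then show ?thesis by (simp add: algebra_simps)
qed

lemma length_final_code: "length (final_code N r) \<le> 80 + 50 * N + 20 * (N * N)"
proof -
  let ?f1 = "\<lambda>j. FScale (SReg (3 + 2 * (N * N) + N + j * N + (N - 1))) (FConj (FPhi j))"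
  let ?f2 = "\<lambda>j. FMul (FConj (FPhi j)) (FReg (6 + j))"
  let ?f3 = "\<lambda>j. FMul (FConj (FPhi j)) (FPoisson (FMul (FReg (6 + j)) (FReg 2)))"
  let ?f4 = "\<lambda>i j. FMul (FConj (FPhi i))
         (FMul (FPoisson (FMul (FReg (6 + i)) (FConj (FPhi j)))) (FReg (6 + j)))"
  let ?f5 = "\<lambda>i. FScale (SInt (FMul (FReg (6 + i)) (FReg 5))) (FConj (FPhi i))"
  have b1: "length (fcompile (fsum ?f1 N) r) \<le> 3 + N * Suc 5" for r
    by (rule length_fsum) simp
  have b2: "length (fcompile (fsum ?f2 N) r) \<le> 3 + N * Suc 5" for r
    by (rule length_fsum) simp
  have b3: "length (fcompile (fsum ?f3 N) r) \<le> 3 + N * Suc 9" for r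
    by (rule length_fsum) simp
  have b4: "length (fcompile (fsum (\<lambda>i. fsum (?f4 i) N) N) r) \<le> 3 + N * Suc (3 + N * Suc 12)" for r
    by (intro length_fsum) simp
  have b5: "length (fcompile (fsum ?f5 N) r) \<le> 3 + N * Suc 9" for r
    by (rule length_fsum) simp
  show ?thesis
    using b1[of r] b2[of r] b3[of "Suc (Suc r)"] b4[of "Suc (Suc r)"] b5[of "Suc (Suc (Suc (Suc r)))"]
    by (simp add: final_code_def fassign_def sassign_def algebra_simps)
qed

text \<open>The cost claim concerns all N and M, not only large ones. The finitely many values
  before the asymptotic bound sets in are absorbed into the constant, which is possible because g is
  positive there.\<close>

lemma bigo_sequentially_bound:
  fixes f g :: "nat \<Rightarrow> real"
  assumes "f \<in> O(g)" and pos: "\<And>n. m \<le> n \<Longrightarrow> 0 < g n"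
  obtains K where "0 \<le> K" "\<And>n. m \<le> n \<Longrightarrow> \<bar>f n\<bar> \<le> K * g n"
proof -
  obtain c where c: "0 < c" "eventually (\<lambda>n. norm (f n) \<le> c * norm (g n)) at_top"
    using landau_o.bigE[OF assms(1)] by blast
  then obtain n0 where n0: "\<And>n. n0 \<le> n \<Longrightarrow> \<bar>f n\<bar> \<le> c * \<bar>g n\<bar>"
    by (auto simp: eventually_at_top_linorder)
  define K where "K = c + (\<Sum>n\<in>{m..<n0}. \<bar>f n\<bar> / g n)"
  have sum_pos: "0 \<le> (\<Sum>n\<in>{m..<n0}. \<bar>f n\<bar> / g n)"
    using pos by (intro sum_nonneg divide_nonneg_pos) auto
  show ?thesis
  proof
    show "0 \<le> K" using c(1) sum_pos by (simp add: K_def)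
    fix n assume n: "m \<le> n"
    show "\<bar>f n\<bar> \<le> K * g n"
    proof (cases "n0 \<le> n")
      case True
      then have "\<bar>f n\<bar> \<le> c * g n" using n0[of n] pos[OF n] by simp
      also have "\<dots> \<le> K * g n"
        using sum_pos pos[OF n] by (intro mult_right_mono) (auto simp: K_def)
      finally show ?thesis .
    next
      case False
      have "\<bar>f n\<bar> / g n \<le> (\<Sum>n\<in>{m..<n0}. \<bar>f n\<bar> / g n)"
        using False n pos by (intro member_le_sum divide_nonneg_pos) auto
      also have "\<dots> \<le> K" using c(1) by (simp add: K_def)
      finally show ?thesis using pos[OF n] by (simp add: divide_le_eq)
    qed
  qed
qed

text \<open>The 3 counts the decomposition, the inverse and the determinant. The four length bounds
  add up to 33 N^2 + 63 N + 80, which is at most 176 N^2.\<close>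

lemma program_cost_formula_code:
  assumes "1 \<le> N"
  shows "program_cost cS cF cW cL N M (formula_code N)
    \<le> 3 * \<bar>cL N\<bar> + 176 * real N ^ 2 * (\<bar>cS\<bar> + \<bar>cF M\<bar> + \<bar>cW M\<bar>)"
proof -
  define r where "r = 10 + 4 * (N * N) + N"
  define p where "p = setup_code N r @ null_vector_code N r @ theta_code N r @ final_code N r"
  have "list_all elementary p"
    by (simp add: p_def setup_code_def null_vector_code_def theta_code_def final_code_def
        list_all_concat elementary_assign)
  moreover have "real (length p) \<le> 176 * real N ^ 2"
  proof -
    have "N \<le> N * N" "1 \<le> N * N" using assms by auto
    then have "length p \<le> 176 * (N * N)"
      using length_setup_code[of N r] length_null_vector_code[of N r] length_theta_code[of N r]
        length_final_code[of N r] unfolding p_def length_append by linarith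
    then have "real (length p) \<le> real (176 * (N * N))" by (simp only: of_nat_le_iff)
    then show ?thesis by (simp add: power2_eq_square)
  qed
  ultimately have "program_cost cS cF cW cL N M p \<le> 176 * real N ^ 2 * (\<bar>cS\<bar> + \<bar>cF M\<bar> + \<bar>cW M\<bar>)"
    by (intro order.trans[OF program_cost_elementary] mult_right_mono) auto
  moreover have "program_cost cS cF cW cL N M (formula_code N) = 3 * cL N + program_cost cS cF cW cL N M p"
    unfolding formula_code_def Let_def r_def[symmetric] p_def program_cost_append
    by (simp add: program_cost_def svd_code_def inverse_code_def)
  ultimately show ?thesis by linarith
qed

lemma formula_code_cost:
  assumes "cF \<in> O(\<lambda>M. real M)" "cW \<in> O(\<lambda>M. real M * ln (real M))" "cL \<in> O(\<lambda>N. real N ^ 3)"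
  shows "\<exists>C. \<forall>N M. 1 \<le> N \<and> N \<le> M \<longrightarrow>
    program_cost cS cF cW cL N M (formula_code N) \<le> C * (real N ^ 3 + real N ^ 2 * (real M * ln (real M)))"
proof -
  obtain KF where KF: "0 \<le> KF" "\<And>n. 1 \<le> n \<Longrightarrow> \<bar>cF n\<bar> \<le> KF * real n"
    by (rule bigo_sequentially_bound[OF assms(1), of 1]) auto
  \<comment> \<open>The bound starts at 2 because M ln M vanishes at M = 1.\<close>
  obtain KW where KW: "0 \<le> KW" "\<And>n. 2 \<le> n \<Longrightarrow> \<bar>cW n\<bar> \<le> KW * (real n * ln (real n))"
    by (rule bigo_sequentially_bound[OF assms(2), of 2]) auto
  obtain KL where KL: "0 \<le> KL" "\<And>n. 1 \<le> n \<Longrightarrow> \<bar>cL n\<bar> \<le> KL * real n ^ 3"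
    by (rule bigo_sequentially_bound[OF assms(3), of 1]) auto
  \<comment> \<open>A collects the unit costs for M >= 2, where M is at most twice M ln M (hence the
    2) and M ln M is at least 1; B is the unit cost at M = 1.\<close>
  define A where "A = \<bar>cS\<bar> + 2 * KF + KW"
  define B where "B = \<bar>cS\<bar> + \<bar>cF 1\<bar> + \<bar>cW 1\<bar>"
  have nonneg: "0 \<le> A" "0 \<le> B" using KF KW by (auto simp: A_def B_def)
  show ?thesis
  proof (intro exI allI impI)
    fix N M :: nat assume NM: "1 \<le> N \<and> N \<le> M"
    define m where "m = real M * ln (real M)"
    have m: "0 \<le> m" using NM by (simp add: m_def)
    have unit: "176 * real N ^ 2 * (\<bar>cS\<bar> + \<bar>cF M\<bar> + \<bar>cW M\<bar>)
        \<le> 176 * A * (real N ^ 2 * m) + 176 * B * real N ^ 3"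
    \<comment> \<open>For M = 1 the logarithm vanishes, but then N = 1 as well and the summand with
      N^3 carries the cost.\<close>
    proof (cases "M = 1")
      case True
      then show ?thesis using NM nonneg m by (auto simp: B_def)
    next
      case False
      then have M: "2 \<le> M" using NM by simp
      have "1 / 2 \<le> ln (real M)"
        using M ln2_ge_two_thirds ln_le_cancel_iff[of 2 "real M"] by linarith
      then have "real M * (1 / 2) \<le> m" unfolding m_def using M by (intro mult_left_mono) auto
      then have M2: "real M \<le> 2 * m" "1 \<le> m" using M by auto
      have "\<bar>cS\<bar> \<le> \<bar>cS\<bar> * m" using mult_left_mono[OF M2(2), of "\<bar>cS\<bar>"] by simp
      moreover have "\<bar>cF M\<bar> \<le> 2 * KF * m"
        using KF(2)[of M] M mult_left_mono[OF M2(1) KF(1)] by simp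
      moreover have "\<bar>cW M\<bar> \<le> KW * m"
        using KW(2)[OF M] by (simp add: m_def)
      ultimately have "\<bar>cS\<bar> + \<bar>cF M\<bar> + \<bar>cW M\<bar> \<le> A * m"
        by (simp add: A_def algebra_simps)
      then have "176 * real N ^ 2 * (\<bar>cS\<bar> + \<bar>cF M\<bar> + \<bar>cW M\<bar>) \<le> 176 * real N ^ 2 * (A * m)"
        by (intro mult_left_mono) auto
      moreover have "0 \<le> 176 * B * real N ^ 3" using nonneg by simp
      ultimately show ?thesis by (simp add: algebra_simps)
    qed
    have "program_cost cS cF cW cL N M (formula_code N)
        \<le> 3 * (KL * real N ^ 3) + (176 * A * (real N ^ 2 * m) + 176 * B * real N ^ 3)"
      using program_cost_formula_code[of N cS cF cW cL M] unit KL(2)[of N] NM by linarith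
    also have "\<dots> \<le> (3 * KL + 176 * A + 176 * B) * (real N ^ 3 + real N ^ 2 * m)"
      using nonneg KL(1) m by (simp add: algebra_simps add_increasing add_increasing2)
    finally show "program_cost cS cF cW cL N M (formula_code N)
        \<le> (3 * KL + 176 * A + 176 * B) * (real N ^ 3 + real N ^ 2 * (real M * ln (real M)))"
      by (simp add: m_def)
  qed
qed

subsection \<open>Integrals over several particles\<close>

lemma sigma_finite_particle_measure: "sigma_finite_measure particle_measure"
proof -
  interpret C: sigma_finite_measure "count_space (UNIV :: spin set)"
    by (rule sigma_finite_measure_count_space_finite) (simp add: UNIV_spin)
  interpret pair_sigma_finite "lborel :: (real ^ 3) measure" "count_space (UNIV :: spin set)" ..
  show ?thesis
    unfolding particle_measure_def by (rule sigma_finite_measure_axioms)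
qed

interpretation particle: sigma_finite_measure particle_measure
  by (rule sigma_finite_particle_measure)

interpretation particle2: pair_sigma_finite particle_measure particle_measure ..

interpretation particles: product_sigma_finite "\<lambda>_. particle_measure"
  by unfold_locales

lemma has_integral_one_body_product:
  fixes f :: "'i \<Rightarrow> orbital"
  assumes "finite I" "\<And>i. i \<in> I \<Longrightarrow> integrable particle_measure (f i)"
  shows "has_bochner_integral (Pi\<^sub>M I (\<lambda>_. particle_measure)) (\<lambda>x. \<Prod>i\<in>I. f i (x i))
    (\<Prod>i\<in>I. integral\<^sup>L particle_measure (f i))"
  using particles.product_integrable_prod[OF assms] particles.product_integral_prod[OF assms]
  by (simp add: has_bochner_integral_iff)

text \<open>Fubini with coordinate k integrated first: what remains is again a product of functions
  of one coordinate each, with a partial integral of g at l. This is done once with norms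
  (\<open>h\<close>), which gives integrability, and once for the value (\<open>p\<close>).\<close>

lemma has_integral_two_body_product:
  fixes f :: "'i \<Rightarrow> orbital"
  assumes I: "finite I" "k \<notin> I" "l \<notin> I" "k \<noteq> l"
    and g: "integrable (particle_measure \<Otimes>\<^sub>M particle_measure) g"
    and f: "\<And>i. i \<in> I \<Longrightarrow> integrable particle_measure (f i)"
  shows "has_bochner_integral (Pi\<^sub>M (insert k (insert l I)) (\<lambda>_. particle_measure))
    (\<lambda>x. g (x k, x l) * (\<Prod>i\<in>I. f i (x i)))
    ((\<integral>z. g z \<partial>(particle_measure \<Otimes>\<^sub>M particle_measure)) *
      (\<Prod>i\<in>I. integral\<^sup>L particle_measure (f i)))"
proof -
  let ?J = "insert l I"
  let ?M = "Pi\<^sub>M (insert k ?J) (\<lambda>_. particle_measure)"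
  let ?F = "\<lambda>x. g (x k, x l) * (\<Prod>i\<in>I. f i (x i))"
  have [measurable]: "g \<in> borel_measurable (particle_measure \<Otimes>\<^sub>M particle_measure)"
    using g by simp
  have fm: "f i \<in> borel_measurable particle_measure" if "i \<in> I" for i
    using f[OF that] by simp
  have J: "finite ?J" "k \<notin> ?J" using I by auto
  have meas_prod: "(\<lambda>x. \<Prod>i\<in>I. f i (x i)) \<in> borel_measurable ?M"
  proof (intro borel_measurable_prod)
    fix i assume i: "i \<in> I"
    have "(\<lambda>x. x i) \<in> ?M \<rightarrow>\<^sub>M particle_measure"
      using i by (intro measurable_component_singleton) simp
    from measurable_compose[OF this fm[OF i]]
    show "(\<lambda>x. f i (x i)) \<in> borel_measurable ?M" .
  qed
  have meas: "?F \<in> borel_measurable ?M"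
    by (intro borel_measurable_times meas_prod) measurable
  define h where "h = (\<lambda>i. if i = l then (\<lambda>z. \<integral>\<^sup>+y. ennreal (norm (g (y, z))) \<partial>particle_measure)
    else (\<lambda>z. ennreal (norm (f i z))))"
  have "(\<integral>\<^sup>+x. ennreal (norm (?F x)) \<partial>?M)
      = (\<integral>\<^sup>+x. \<integral>\<^sup>+y. ennreal (norm (?F (x(k := y)))) \<partial>particle_measure
          \<partial>Pi\<^sub>M ?J (\<lambda>_. particle_measure))"
    by (intro particles.product_nn_integral_insert[OF J]
        measurable_compose[OF measurable_compose[OF meas borel_measurable_norm] measurable_ennreal])
  also have "\<dots> = (\<integral>\<^sup>+x. (\<Prod>i\<in>?J. h i (x i)) \<partial>Pi\<^sub>M ?J (\<lambda>_. particle_measure))"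
  proof (intro nn_integral_cong)
    fix x assume x: "x \<in> space (Pi\<^sub>M ?J (\<lambda>_. particle_measure))"
    then have [measurable]: "x l \<in> space particle_measure" by (auto simp: space_PiM)
    have "(\<Prod>i\<in>I. f i ((x(k := y)) i)) = (\<Prod>i\<in>I. f i (x i))" for y
      using I by (intro prod.cong) auto
    then have "(\<integral>\<^sup>+y. ennreal (norm (?F (x(k := y)))) \<partial>particle_measure)
        = (\<integral>\<^sup>+y. ennreal (norm (g (y, x l))) * ennreal (norm (\<Prod>i\<in>I. f i (x i))) \<partial>particle_measure)"
      using I by (simp add: norm_mult ennreal_mult')
    also have "\<dots> = (\<integral>\<^sup>+y. ennreal (norm (g (y, x l))) \<partial>particle_measure) * ennreal (norm (\<Prod>i\<in>I. f i (x i)))"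
      by (intro nn_integral_multc) measurable
    also have "ennreal (norm (\<Prod>i\<in>I. f i (x i))) = (\<Prod>i\<in>I. h i (x i))"
      using I by (auto simp: prod_norm[symmetric] prod_ennreal[symmetric] h_def intro!: prod.cong)
    finally show "(\<integral>\<^sup>+y. ennreal (norm (?F (x(k := y)))) \<partial>particle_measure) = (\<Prod>i\<in>?J. h i (x i))"
      using I by (simp add: h_def)
  qed
  also have "\<dots> = (\<Prod>i\<in>?J. \<integral>\<^sup>+z. h i z \<partial>particle_measure)"
  proof (intro particles.product_nn_integral_prod)
    fix i assume "i \<in> ?J"
    then show "h i \<in> borel_measurable particle_measure"
      using fm by (cases "i = l") (auto simp: h_def)
  qed (use I in auto)
  also have "\<dots> < \<infinity>"
  proof -
    have "(\<integral>\<^sup>+z. h l z \<partial>particle_measure)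
        = (\<integral>\<^sup>+z. ennreal (norm (g z)) \<partial>(particle_measure \<Otimes>\<^sub>M particle_measure))"
      using particle2.nn_integral_snd[of "\<lambda>z. ennreal (norm (g z))"] by (simp add: h_def)
    also have "\<dots> < \<infinity>" using g by (simp add: integrable_iff_bounded)
    finally have "(\<integral>\<^sup>+z. h l z \<partial>particle_measure) < \<infinity>" .
    moreover have "(\<integral>\<^sup>+z. h i z \<partial>particle_measure) < \<infinity>" if "i \<in> I" for i
      using f[OF that] that I by (auto simp: h_def integrable_iff_bounded)
    ultimately show ?thesis
      using I(1) by (simp add: less_top[symmetric] ennreal_prod_eq_top)
  qed
  finally have integrable: "integrable ?M ?F"
    using meas by (simp add: integrable_iff_bounded)
  define p where "p = (\<lambda>i. if i = l then (\<lambda>z. \<integral>y. g (y, z) \<partial>particle_measure) else f i)"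
  have p: "integrable particle_measure (p i)" if "i \<in> ?J" for i
    using that f particle2.integrable_snd[of "\<lambda>x y. g (x, y)"] g by (auto simp: p_def)
  have "integral\<^sup>L ?M ?F = (\<integral>x. \<integral>y. ?F (x(k := y)) \<partial>particle_measure \<partial>Pi\<^sub>M ?J (\<lambda>_. particle_measure))"
    by (rule particles.product_integral_insert[OF J integrable])
  also have "\<dots> = (\<integral>x. (\<Prod>i\<in>?J. p i (x i)) \<partial>Pi\<^sub>M ?J (\<lambda>_. particle_measure))"
  proof (intro Bochner_Integration.integral_cong refl)
    fix x :: "'i \<Rightarrow> particle"
    have "(\<Prod>i\<in>I. f i ((x(k := y)) i)) = (\<Prod>i\<in>I. p i (x i))" for y
      using I by (intro prod.cong) (auto simp: p_def)
    then show "(\<integral>y. ?F (x(k := y)) \<partial>particle_measure) = (\<Prod>i\<in>?J. p i (x i))"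
      using I by (simp add: p_def)
  qed
  also have "\<dots> = (\<Prod>i\<in>?J. integral\<^sup>L particle_measure (p i))"
    by (intro particles.product_integral_prod p J)
  also have "\<dots> = (\<integral>z. g z \<partial>(particle_measure \<Otimes>\<^sub>M particle_measure)) *
      (\<Prod>i\<in>I. integral\<^sup>L particle_measure (f i))"
  proof -
    have "integral\<^sup>L particle_measure (p l) = (\<integral>z. g z \<partial>(particle_measure \<Otimes>\<^sub>M particle_measure))"
      using particle2.integral_snd[of "\<lambda>x y. g (x, y)"] g by (simp add: p_def)
    moreover have "(\<Prod>i\<in>I. integral\<^sup>L particle_measure (p i)) = (\<Prod>i\<in>I. integral\<^sup>L particle_measure (f i))"
      using I by (intro prod.cong) (auto simp: p_def)
    ultimately show ?thesis using I by simp
  qed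
  finally show ?thesis
    using integrable by (simp add: has_bochner_integral_iff)
qed

lemma integrable_overlap:
  assumes "square_integrable f" "square_integrable g"
  shows "integrable particle_measure (\<lambda>x. f x * cnj (g x))"
proof (rule Bochner_Integration.integrable_bound)
  show "integrable particle_measure (\<lambda>x. (norm (f x))\<^sup>2 + (norm (g x))\<^sup>2)"
    using assms by (simp add: square_integrable_def)
  have [measurable]: "f \<in> borel_measurable particle_measure" "g \<in> borel_measurable particle_measure"
    using assms by (simp_all add: square_integrable_def)
  show "(\<lambda>x. f x * cnj (g x)) \<in> borel_measurable particle_measure"
    by (intro borel_measurable_times borel_measurable_continuous_on[OF continuous_on_cnj[OF continuous_on_id]])
      measurable
  show "AE x in particle_measure. norm (f x * cnj (g x)) \<le> norm ((norm (f x))\<^sup>2 + (norm (g x))\<^sup>2)"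
  proof (intro AE_I2)
    fix x
    have "norm (f x) * norm (g x) \<le> (norm (f x))\<^sup>2 + (norm (g x))\<^sup>2"
      using sum_squares_bound[of "norm (f x)" "norm (g x)"]
        mult_nonneg_nonneg[OF norm_ge_zero norm_ge_zero, of "f x" "g x"] by linarith
    then show "norm (f x * cnj (g x)) \<le> norm ((norm (f x))\<^sup>2 + (norm (g x))\<^sup>2)"
      by (simp add: norm_mult)
  qed
qed

section \<open>The Coulomb interaction and antisymmetrized products\<close>

definition coulomb_kernel :: "particle \<Rightarrow> particle \<Rightarrow> complex" where
  "coulomb_kernel x y = complex_of_real (1 / norm (fst x - fst y))"

lemma coulomb_kernel_sym: "coulomb_kernel x y = coulomb_kernel y x"
  by (simp add: coulomb_kernel_def norm_minus_commute)

lemma coulomb_eq: "coulomb N x = 1 / 2 * (\<Sum>k<N. \<Sum>l\<in>{..<N} - {k}. coulomb_kernel (x k) (x l))"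
  by (simp add: coulomb_def coulomb_kernel_def)

lemma coulomb_permute:
  assumes "\<pi> permutes {..<N}"
  shows "coulomb N (\<lambda>i. x (\<pi> i)) = coulomb N x"
proof -
  have "(\<Sum>k<N. \<Sum>l\<in>{..<N} - {k}. coulomb_kernel (x (\<pi> k)) (x (\<pi> l)))
      = (\<Sum>k<N. \<Sum>l\<in>{..<N} - {\<pi> k}. coulomb_kernel (x (\<pi> k)) (x l))"
  proof (rule sum.cong[OF refl], rule sum.reindex_bij_betw)
    fix k assume "k \<in> {..<N}"
    then show "bij_betw \<pi> ({..<N} - {k}) ({..<N} - {\<pi> k})"
      using permutes_inj_on[OF assms] permutes_image[OF assms] image_set_diff[OF permutes_inj[OF assms]]
      by (simp add: bij_betw_def)
  qed
  also have "\<dots> = (\<Sum>k<N. \<Sum>l\<in>{..<N} - {k}. coulomb_kernel (x k) (x l))"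
    by (rule sum.reindex_bij_betw[OF permutes_imp_bij[OF assms]])
  finally show ?thesis by (simp add: coulomb_eq)
qed

text \<open>The interaction is real and symmetric, so it leaves the antisymmetrizer. Passing to
  inverse permutations, which have the same sign, moves the permutation from the particles to the
  orbitals; what remains is a Leibniz sum with particles as rows.\<close>

lemma antisymmetrizer_coulomb_product:
  "cnj (antisymmetrizer N (\<lambda>x. coulomb N x * (\<Prod>i<N. \<phi> i (x i))) x)
    = 1 / fact N * (coulomb N x *
        (\<Sum>\<pi> | \<pi> permutes {..<N}. of_int (sign \<pi>) * (\<Prod>i<N. cnj (\<phi> (\<pi> i) (x i)))))"
proof -
  have "(\<Sum>\<pi> | \<pi> permutes {..<N}. of_int (sign \<pi>) * (\<Prod>i<N. cnj (\<phi> i (x (\<pi> i)))))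
      = (\<Sum>\<pi> | \<pi> permutes {..<N}. of_int (sign \<pi>) * (\<Prod>i<N. cnj (\<phi> (\<pi> i) (x i))))"
  proof (subst sum_permutations_inverse, rule sum.cong[OF refl])
    fix \<pi> assume "\<pi> \<in> {\<pi>. \<pi> permutes {..<N}}"
    then have \<pi>: "\<pi> permutes {..<N}" by simp
    have "(\<Prod>i<N. cnj (\<phi> i (x (inv_into UNIV \<pi> i)))) = (\<Prod>i<N. cnj (\<phi> (\<pi> i) (x (inv_into UNIV \<pi> (\<pi> i)))))"
      by (rule prod.reindex_bij_betw[OF permutes_imp_bij[OF \<pi>], symmetric])
    then show "of_int (sign (inv_into UNIV \<pi>)) * (\<Prod>i<N. cnj (\<phi> i (x (inv_into UNIV \<pi> i))))
        = of_int (sign \<pi>) * (\<Prod>i<N. cnj (\<phi> (\<pi> i) (x i)))"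
      using permutes_inverses(2)[OF \<pi>] permutation_permutes[of \<pi>] \<pi> finite_lessThan
      by (auto simp: sign_inverse)
  qed
  moreover have "cnj (antisymmetrizer N (\<lambda>x. coulomb N x * (\<Prod>i<N. \<phi> i (x i))) x)
      = 1 / fact N * (\<Sum>\<pi> | \<pi> permutes {..<N}.
          coulomb N x * (of_int (sign \<pi>) * (\<Prod>i<N. cnj (\<phi> i (x (\<pi> i))))))"
  proof -
    have "cnj (coulomb N x) = coulomb N x" by (simp add: coulomb_def)
    then have "cnj (of_int (sign \<pi>) * (coulomb N (\<lambda>i. x (\<pi> i)) * (\<Prod>i<N. \<phi> i (x (\<pi> i)))))
        = coulomb N x * (of_int (sign \<pi>) * (\<Prod>i<N. cnj (\<phi> i (x (\<pi> i)))))"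
      if "\<pi> permutes {..<N}" for \<pi>
      by (simp add: coulomb_permute[OF that])
    then have "(\<Sum>\<pi> | \<pi> permutes {..<N}. cnj (of_int (sign \<pi>) *
          (coulomb N (\<lambda>i. x (\<pi> i)) * (\<Prod>i<N. \<phi> i (x (\<pi> i))))))
        = (\<Sum>\<pi> | \<pi> permutes {..<N}.
          coulomb N x * (of_int (sign \<pi>) * (\<Prod>i<N. cnj (\<phi> i (x (\<pi> i))))))"
      by (intro sum.cong) auto
    then show ?thesis
      unfolding antisymmetrizer_def complex_cnj_mult[of "1 / fact N"] cnj_sum by simp
  qed
  ultimately show ?thesis
    by (simp only: sum_distrib_left[symmetric])
qed

lemma sum_prod_expand:
  fixes A B :: "nat \<Rightarrow> nat \<Rightarrow> complex"
  shows "(\<Sum>k<N. \<Sum>j<N. A k j) * (\<Sum>l<N. \<Sum>m<N. B l m) = (\<Sum>k<N. \<Sum>j<N. \<Sum>l<N. \<Sum>m<N. A k j * B l m)"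
  by (simp only: sum_distrib_right) (simp only: sum_distrib_left)

section \<open>Integrating out all particles but the first\<close>

locale orbitals_setting =
  fixes N :: nat and \<phi> \<phi>t :: "nat \<Rightarrow> orbital" and d :: "complex vec"
  assumes nonsingular: "nonsingular_setting N \<phi> \<phi>t d"
begin

definition E :: "nat \<Rightarrow> nat \<Rightarrow> complex" where "E i j = E_mat N \<phi> \<phi>t d $$ (i, j)"

definition pair :: "nat \<Rightarrow> nat \<Rightarrow> orbital" where "pair k j x = \<phi>t k x * cnj (\<phi> j x)"

definition one_body :: "particle \<Rightarrow> nat \<Rightarrow> nat \<Rightarrow> complex" where
  "one_body \<gamma> k j = (\<integral>y. coulomb_kernel \<gamma> y * pair k j y \<partial>particle_measure)"

text \<open>The first two indices are the particles, that is rows, and the last two are columns;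
  \<open>two_body k l j\<close> is thus a row in its own right and can be inserted into a
  determinant.\<close>

definition two_body :: "nat \<Rightarrow> nat \<Rightarrow> nat \<Rightarrow> nat \<Rightarrow> complex" where
  "two_body k l j m = (\<integral>z. coulomb_kernel (fst z) (snd z) * (pair k j (fst z) * pair l m (snd z))
     \<partial>(particle_measure \<Otimes>\<^sub>M particle_measure))"

lemma N_pos: "0 < N"
  using nonsingular by (simp add: nonsingular_setting_def)

sublocale theta_setting N \<phi> \<phi>t d
  using nonsingular mat_inverse_of_invertible[OF E_mat_carrier]
  by unfold_locales (auto simp: nonsingular_setting_def unit_null_vector_def)

lemma inverse_E: "the (mat_inverse (E_mat N \<phi> \<phi>t d)) * E_mat N \<phi> \<phi>t d = 1\<^sub>m N"
  using nonsingular mat_inverse_of_invertible[OF E_mat_carrier]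
  by (auto simp: nonsingular_setting_def)

sublocale row_inverse N E F
proof
  fix i j assume "i < N" "j < N"
  then have "(\<Sum>m<N. F i m * E m j) = (the (mat_inverse (E_mat N \<phi> \<phi>t d)) * E_mat N \<phi> \<phi>t d) $$ (i, j)"
    using carrier_matD[OF inverse_carrier] carrier_matD[OF E_mat_carrier[of N \<phi> \<phi>t d]]
    by (simp add: E_def F_def scalar_prod_def atLeast0LessThan)
  then show "(\<Sum>m<N. F i m * E m j) = (if i = j then 1 else 0)"
    using \<open>i < N\<close> \<open>j < N\<close> by (simp add: inverse_E)
qed

lemma rowdet_E: "rowdet N E = Determinant.det (E_mat N \<phi> \<phi>t d)"
proof -
  have "mat N N (\<lambda>(i, j). E i j) = E_mat N \<phi> \<phi>t d"
    by (intro eq_matI) (auto simp: E_def E_mat_def)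
  then show ?thesis by (simp add: rowdet_def)
qed

lemma E_overlap: "i \<in> {1..<N} \<Longrightarrow> j < N \<Longrightarrow> E i j = integral\<^sup>L particle_measure (pair i j)"
  by (simp add: E_def E_mat_def braket_def pair_def[abs_def])

text \<open>d is a unit vector orthogonal to the other rows, so E d is the first unit
  vector.\<close>

lemma F_first_column:
  assumes "i < N"
  shows "F i 0 = d $ i"
proof -
  have null: "unit_null_vector N \<phi> \<phi>t d" using nonsingular by (simp add: nonsingular_setting_def)
  then have "overlap_mat N \<phi> \<phi>t *\<^sub>v d = 0\<^sub>v N" "d \<bullet>* d = 1"
    using overlap_mat_null_vector[OF d_carrier] by (auto simp: unit_null_vector_def)
  then have "E_mat N \<phi> \<phi>t d *\<^sub>v d = unit_vec N 0"
    using E_mat_mult_null_vector[OF null d_carrier] N_pos by simp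
  moreover have "the (mat_inverse (E_mat N \<phi> \<phi>t d)) *\<^sub>v (E_mat N \<phi> \<phi>t d *\<^sub>v d) = d"
    using assoc_mult_mat_vec[OF inverse_carrier E_mat_carrier[of N \<phi> \<phi>t d] d_carrier] inverse_E d_carrier by simp
  ultimately have "d $ i = (the (mat_inverse (E_mat N \<phi> \<phi>t d)) *\<^sub>v unit_vec N 0) $ i"
    by simp
  then show ?thesis
    using assms N_pos inverse_carrier by (simp add: F_def scalar_prod_right_unit)
qed

lemma integrable_pair: "i < N \<Longrightarrow> j < N \<Longrightarrow> integrable particle_measure (pair i j)"
  unfolding pair_def[abs_def] using nonsingular
  by (intro integrable_overlap) (auto simp: nonsingular_setting_def admissible_def)

lemma integrable_one_body:
  "k < N \<Longrightarrow> j < N \<Longrightarrow> integrable particle_measure (\<lambda>y. coulomb_kernel \<gamma> y * pair k j y)"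
  using nonsingular unfolding nonsingular_setting_def admissible_def coulomb_kernel_def pair_def
  by blast

lemma integrable_two_body:
  assumes "k < N" "j < N" "l < N" "m < N"
  shows "integrable (particle_measure \<Otimes>\<^sub>M particle_measure)
    (\<lambda>z. coulomb_kernel (fst z) (snd z) * (pair k j (fst z) * pair l m (snd z)))"
proof -
  have "integrable (particle_measure \<Otimes>\<^sub>M particle_measure)
    (\<lambda>(x, y). complex_of_real (1 / norm (fst x - fst y)) *
       (\<phi>t k x * cnj (\<phi> j x)) * (\<phi>t l y * cnj (\<phi> m y)))"
    using nonsingular assms unfolding nonsingular_setting_def admissible_def by blast
  then show ?thesis
    by (simp add: coulomb_kernel_def pair_def split_beta' mult.assoc)
qed

text \<open>Fubini links the double integrals of the inner product with the closed formula, where a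
  Poisson convolution is multiplied by functions and then integrated.\<close>

lemma two_body_iterated:
  assumes "k < N" "j < N" "l < N" "m < N"
  shows "has_bochner_integral particle_measure (\<lambda>x. pair k j x * one_body x l m) (two_body k l j m)"
proof -
  let ?f = "\<lambda>x y. coulomb_kernel x y * (pair k j x * pair l m y)"
  have "integrable (particle_measure \<Otimes>\<^sub>M particle_measure) (case_prod ?f)"
    using integrable_two_body[OF assms] by (simp add: split_beta')
  note int = particle2.integrable_fst[OF this] particle2.integral_fst[OF this]
  have "(\<integral>y. ?f x y \<partial>particle_measure) = pair k j x * one_body x l m" for x
    unfolding one_body_def by (subst integral_mult_right_zero[symmetric]) (simp add: mult.left_commute)
  with int show ?thesis
    by (simp add: has_bochner_integral_iff two_body_def split_beta')
qed

text \<open>Exchanging the two particles leaves the kernel unchanged. This later merges two of the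
  three cofactors of the minor of order 3.\<close>

lemma two_body_sym:
  assumes "k < N" "j < N" "l < N" "m < N"
  shows "two_body k l j m = two_body l k m j"
proof -
  let ?f = "\<lambda>z. coulomb_kernel (fst z) (snd z) * (pair k j (fst z) * pair l m (snd z))"
  have "?f \<in> borel_measurable (particle_measure \<Otimes>\<^sub>M particle_measure)"
    using integrable_two_body[OF assms] by simp
  from particle2.integral_product_swap[OF this] show ?thesis
    by (simp add: two_body_def split_beta' coulomb_kernel_sym[of "snd _"] mult.commute)
qed

lemma poisson_expansion:
  assumes "\<And>x. f x = (\<Sum>k<N. \<Sum>j<N. a k j * pair k j x)"
  shows "poisson f \<gamma> = (\<Sum>k<N. \<Sum>j<N. a k j * one_body \<gamma> k j)"
proof -
  have "poisson f \<gamma> = (\<integral>y. (\<Sum>k<N. \<Sum>j<N. a k j * (coulomb_kernel \<gamma> y * pair k j y)) \<partial>particle_measure)"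
    unfolding poisson_def coulomb_kernel_def[symmetric] assms
    by (simp only: sum_distrib_left mult.left_commute)
  also have "\<dots> = (\<Sum>k<N. \<Sum>j<N. a k j * one_body \<gamma> k j)"
    by (intro has_bochner_integral_integral_eq has_bochner_integral_sum has_bochner_integral_mult_right)
      (simp add: has_bochner_integral_iff one_body_def integrable_one_body)
  finally show ?thesis .
qed

lemma two_body_expansion:
  assumes "\<And>x. f x = (\<Sum>k<N. \<Sum>j<N. \<Sum>l<N. \<Sum>m<N. a k j l m * (pair k j x * one_body x l m))"
  shows "(\<integral>x. f x \<partial>particle_measure) = (\<Sum>k<N. \<Sum>j<N. \<Sum>l<N. \<Sum>m<N. a k j l m * two_body k l j m)"
proof -
  have "has_bochner_integral particle_measure f
      (\<Sum>k<N. \<Sum>j<N. \<Sum>l<N. \<Sum>m<N. a k j l m * two_body k l j m)"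
    unfolding fun_eq_iff[THEN iffD2, OF allI, OF assms]
    by (intro has_bochner_integral_sum has_bochner_integral_mult_right two_body_iterated) auto
  then show ?thesis by (rule has_bochner_integral_integral_eq)
qed

text \<open>The contribution of one permutation and one pair of particles after integration, without
  the orbital factor of the first particle. That particle is fixed at \<gamma>, so a pair containing
  index 0 leaves only a potential evaluated at \<gamma>.\<close>

definition pair_term :: "particle \<Rightarrow> (nat \<Rightarrow> nat) \<Rightarrow> nat \<Rightarrow> nat \<Rightarrow> complex" where
  "pair_term \<gamma> \<pi> k l =
     (if k = 0 then one_body \<gamma> l (\<pi> l) * (\<Prod>i\<in>{..<N} - {0, l}. E i (\<pi> i))
      else if l = 0 then one_body \<gamma> k (\<pi> k) * (\<Prod>i\<in>{..<N} - {0, k}. E i (\<pi> i))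
      else two_body k l (\<pi> k) (\<pi> l) * (\<Prod>i\<in>{..<N} - {0, k, l}. E i (\<pi> i)))"

lemma has_integral_one_body_term:
  assumes "\<pi> permutes {..<N}" "l \<in> {1..<N}"
  shows "has_bochner_integral (Pi\<^sub>M {1..<N} (\<lambda>_. particle_measure))
    (\<lambda>x. coulomb_kernel \<gamma> (x l) * (\<Prod>i\<in>{1..<N}. pair i (\<pi> i) (x i)))
    (one_body \<gamma> l (\<pi> l) * (\<Prod>i\<in>{..<N} - {0, l}. E i (\<pi> i)))"
proof -
  have \<pi>: "\<pi> i < N" if "i < N" for i
    using permutes_in_image[OF assms(1), of i] that by simp
  define f where "f i = (if i = l then (\<lambda>y. coulomb_kernel \<gamma> y * pair l (\<pi> l) y) else pair i (\<pi> i))" for i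
  have split: "(\<Prod>i\<in>{1..<N}. g i) = g l * (\<Prod>i\<in>{..<N} - {0, l}. g i)" for g :: "nat \<Rightarrow> complex"
  proof -
    have "{1..<N} - {l} = {..<N} - {0, l}" by auto
    then show ?thesis using assms(2) by (simp add: prod.remove[of _ l])
  qed
  have int: "integrable particle_measure (f i)" if "i \<in> {1..<N}" for i
    using that \<pi> integrable_one_body integrable_pair by (auto simp: f_def)
  have "(\<Prod>i\<in>{..<N} - {0, l}. f i (x i)) = (\<Prod>i\<in>{..<N} - {0, l}. pair i (\<pi> i) (x i))" for x
    by (intro prod.cong) (auto simp: f_def)
  then have "(\<Prod>i\<in>{1..<N}. f i (x i)) = coulomb_kernel \<gamma> (x l) * (\<Prod>i\<in>{1..<N}. pair i (\<pi> i) (x i))" for x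
    unfolding split by (simp add: f_def mult.assoc)
  moreover have "(\<Prod>i\<in>{1..<N}. integral\<^sup>L particle_measure (f i))
      = one_body \<gamma> l (\<pi> l) * (\<Prod>i\<in>{..<N} - {0, l}. E i (\<pi> i))"
  proof -
    have "(\<Prod>i\<in>{..<N} - {0, l}. integral\<^sup>L particle_measure (f i)) = (\<Prod>i\<in>{..<N} - {0, l}. E i (\<pi> i))"
      using \<pi> by (intro prod.cong) (auto simp: f_def E_overlap)
    then show ?thesis unfolding split by (simp add: f_def one_body_def)
  qed
  ultimately show ?thesis
    using has_integral_one_body_product[of "{1..<N}" f] int by simp
qed

lemma has_integral_pair_term:
  fixes \<gamma> :: particle
  assumes \<pi>: "\<pi> permutes {..<N}" and kl: "k < N" "l < N" "k \<noteq> l"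
  defines "y \<equiv> \<lambda>x. x(0 := \<gamma>)"
  shows "has_bochner_integral (Pi\<^sub>M {1..<N} (\<lambda>_. particle_measure))
    (\<lambda>x. coulomb_kernel (y x k) (y x l) * (\<Prod>i\<in>{1..<N}. pair i (\<pi> i) (x i)))
    (pair_term \<gamma> \<pi> k l)"
proof -
  consider "k = 0" "l \<in> {1..<N}" | "l = 0" "k \<in> {1..<N}" | "k \<in> {1..<N}" "l \<in> {1..<N}"
    using kl by force
  then show ?thesis
  proof cases
    case 1
    then show ?thesis
      using has_integral_one_body_term[OF \<pi>, of l \<gamma>] by (simp add: y_def pair_term_def)
  next
    case 2
    then show ?thesis
      using has_integral_one_body_term[OF \<pi>, of k \<gamma>]
      by (simp add: y_def pair_term_def coulomb_kernel_sym[of _ \<gamma>])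
  next
    case 3
    let ?I = "{..<N} - {0, k, l}"
    have \<pi>_less: "\<pi> i < N" if "i < N" for i
      using permutes_in_image[OF \<pi>, of i] that by simp
    have I: "{1..<N} = insert k (insert l ?I)" using 3 by auto
    have "has_bochner_integral (Pi\<^sub>M {1..<N} (\<lambda>_. particle_measure))
       (\<lambda>x. (case (x k, x l) of z \<Rightarrow> coulomb_kernel (fst z) (snd z) *
          (pair k (\<pi> k) (fst z) * pair l (\<pi> l) (snd z))) * (\<Prod>i\<in>?I. pair i (\<pi> i) (x i)))
       (two_body k l (\<pi> k) (\<pi> l) * (\<Prod>i\<in>?I. integral\<^sup>L particle_measure (pair i (\<pi> i))))"
      unfolding I two_body_def
      using kl \<pi>_less integrable_two_body integrable_pair
      by (intro has_integral_two_body_product) auto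
    moreover have "(\<Prod>i\<in>?I. integral\<^sup>L particle_measure (pair i (\<pi> i))) = (\<Prod>i\<in>?I. E i (\<pi> i))"
      using \<pi>_less by (intro prod.cong) (auto simp: E_overlap)
    moreover have "(\<Prod>i\<in>{1..<N}. pair i (\<pi> i) (x i))
        = pair k (\<pi> k) (x k) * (pair l (\<pi> l) (x l) * (\<Prod>i\<in>?I. pair i (\<pi> i) (x i)))" for x
      unfolding I using kl by simp
    ultimately show ?thesis
      using 3 by (simp add: y_def pair_term_def mult.assoc)
  qed
qed

lemma delta_braket_expansion:
  "delta_braket N \<phi>t (\<lambda>x. coulomb N x * (\<Prod>i<N. \<phi> i (x i))) \<gamma>
    = 1 / fact N * (1 / 2 * (\<Sum>k<N. \<Sum>l\<in>{..<N} - {k}. \<Sum>\<pi> | \<pi> permutes {..<N}.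
        of_int (sign \<pi>) * (cnj (\<phi> (\<pi> 0) \<gamma>) * pair_term \<gamma> \<pi> k l)))"
proof -
  let ?y = "\<lambda>x. x(0 := \<gamma>)"
  have "(\<Prod>i\<in>{1..<N}. \<phi>t i (x i)) * cnj (antisymmetrizer N (\<lambda>x. coulomb N x * (\<Prod>i<N. \<phi> i (x i))) (?y x))
      = 1 / fact N * (1 / 2 * (\<Sum>k<N. \<Sum>l\<in>{..<N} - {k}. \<Sum>\<pi> | \<pi> permutes {..<N}.
        of_int (sign \<pi>) * (cnj (\<phi> (\<pi> 0) \<gamma>) *
          (coulomb_kernel (?y x k) (?y x l) * (\<Prod>i\<in>{1..<N}. pair i (\<pi> i) (x i))))))" (is "?L x = ?R x") for x
  proof -
    \<comment> \<open>The factor of particle 0 is constant in the integration variables and is split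
      off.\<close>
    have "{..<N} = insert 0 {1..<N}" using N_pos by auto
    then have "(\<Prod>i<N. cnj (\<phi> (\<pi> i) (?y x i))) = cnj (\<phi> (\<pi> 0) \<gamma>) * (\<Prod>i\<in>{1..<N}. cnj (\<phi> (\<pi> i) (x i)))" for \<pi>
      by simp
    then have perm: "w * ((\<Prod>i\<in>{1..<N}. \<phi>t i (x i)) *
          (\<Sum>\<pi> | \<pi> permutes {..<N}. of_int (sign \<pi>) * (\<Prod>i<N. cnj (\<phi> (\<pi> i) (?y x i)))))
        = (\<Sum>\<pi> | \<pi> permutes {..<N}. of_int (sign \<pi>) * (cnj (\<phi> (\<pi> 0) \<gamma>) *
          (w * (\<Prod>i\<in>{1..<N}. pair i (\<pi> i) (x i)))))" for w
      by (simp only: sum_distrib_left pair_def prod.distrib mult_ac)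
    define A where "A = (\<Prod>i\<in>{1..<N}. \<phi>t i (x i))"
    define S where "S = (\<Sum>\<pi> | \<pi> permutes {..<N}. of_int (sign \<pi>) * (\<Prod>i<N. cnj (\<phi> (\<pi> i) (?y x i))))"
    have "?L x = 1 / fact N * (1 / 2 * ((\<Sum>k<N. \<Sum>l\<in>{..<N} - {k}. coulomb_kernel (?y x k) (?y x l)) * (A * S)))"
      unfolding antisymmetrizer_coulomb_product A_def[symmetric] S_def[symmetric]
      unfolding coulomb_eq by (simp only: mult_ac)
    also have "\<dots> = ?R x"
      unfolding perm[symmetric] A_def[symmetric] S_def[symmetric] by (simp only: sum_distrib_right)
    finally show ?thesis .
  qed
  moreover have "has_bochner_integral (Pi\<^sub>M {1..<N} (\<lambda>_. particle_measure)) ?R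
      (1 / fact N * (1 / 2 * (\<Sum>k<N. \<Sum>l\<in>{..<N} - {k}. \<Sum>\<pi> | \<pi> permutes {..<N}.
        of_int (sign \<pi>) * (cnj (\<phi> (\<pi> 0) \<gamma>) * pair_term \<gamma> \<pi> k l))))"
    by (intro has_bochner_integral_mult_right has_bochner_integral_sum has_integral_pair_term) auto
  ultimately show ?thesis
    unfolding delta_braket_def by (simp only: has_bochner_integral_integral_eq)
qed

end

subsection \<open>Summation over pairs of particles\<close>

lemma sum_permute4:
  fixes f :: "nat \<Rightarrow> nat \<Rightarrow> nat \<Rightarrow> nat \<Rightarrow> complex"
  shows "(\<Sum>j\<in>A. \<Sum>m\<in>A. \<Sum>l\<in>A. \<Sum>k\<in>A. f k j l m) = (\<Sum>k\<in>A. \<Sum>j\<in>A. \<Sum>l\<in>A. \<Sum>m\<in>A. f k j l m)"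
proof -
  have "(\<Sum>m\<in>A. \<Sum>l\<in>A. \<Sum>k\<in>A. f k j l m) = (\<Sum>k\<in>A. \<Sum>l\<in>A. \<Sum>m\<in>A. f k j l m)" for j
  proof -
    have "(\<Sum>m\<in>A. \<Sum>l\<in>A. \<Sum>k\<in>A. f k j l m) = (\<Sum>l\<in>A. \<Sum>m\<in>A. \<Sum>k\<in>A. f k j l m)"
      by (rule sum.swap)
    also have "\<dots> = (\<Sum>l\<in>A. \<Sum>k\<in>A. \<Sum>m\<in>A. f k j l m)"
      by (rule sum.cong[OF refl], rule sum.swap)
    also have "\<dots> = (\<Sum>k\<in>A. \<Sum>l\<in>A. \<Sum>m\<in>A. f k j l m)"
      by (rule sum.swap)
    finally show ?thesis .
  qed
  then have "(\<Sum>j\<in>A. \<Sum>m\<in>A. \<Sum>l\<in>A. \<Sum>k\<in>A. f k j l m) = (\<Sum>j\<in>A. \<Sum>k\<in>A. \<Sum>l\<in>A. \<Sum>m\<in>A. f k j l m)"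
    by simp
  also have "\<dots> = (\<Sum>k\<in>A. \<Sum>j\<in>A. \<Sum>l\<in>A. \<Sum>m\<in>A. f k j l m)"
    by (rule sum.swap)
  finally show ?thesis .
qed

context orbitals_setting
begin

definition B :: "particle \<Rightarrow> nat \<Rightarrow> complex" where "B \<gamma> j = cnj (\<phi> j \<gamma>)"

text \<open>The minor in columns 0 and l of the matrix with rows \<open>B \<gamma>\<close> and
  \<open>one_body \<gamma> l\<close>, multiplied by the inverse of E.\<close>

definition minor2 :: "particle \<Rightarrow> nat \<Rightarrow> complex" where
  "minor2 \<gamma> l = co (B \<gamma>) 0 * co (one_body \<gamma> l) l - co (B \<gamma>) l * co (one_body \<gamma> l) 0"

text \<open>Minors in columns 0, k and l, Laplace expanded along \<open>B \<gamma>\<close> and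
  summed over j. The entries of F are the coordinates of the unit row j, and the third row is
  \<open>two_body k l j\<close>.\<close>

definition minor3 :: "particle \<Rightarrow> nat \<Rightarrow> nat \<Rightarrow> complex" where
  "minor3 \<gamma> k l = (\<Sum>j<N.
     co (B \<gamma>) 0 * (F j k * co (two_body k l j) l - F j l * co (two_body k l j) k)
     - co (B \<gamma>) k * (F j 0 * co (two_body k l j) l - F j l * co (two_body k l j) 0)
     + co (B \<gamma>) l * (F j 0 * co (two_body k l j) k - F j k * co (two_body k l j) 0))"

text \<open>The first column of \<open>F\<close> is \<open>d\<close>, so these are expansions of determinants having two equal
  columns.  Hence the sums over pairs of distinct particles extend to all pairs of indices, and
  the first entry of $\tilde\Phi$ has no influence.\<close>

lemma minor_degenerate: "minor2 \<gamma> 0 = 0" "minor3 \<gamma> 0 l = 0" "minor3 \<gamma> k 0 = 0" "minor3 \<gamma> k k = 0"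
  by (auto simp: minor2_def minor3_def algebra_simps)

lemma Leibniz_one_body:
  assumes "l \<in> {1..<N}"
  shows "(\<Sum>\<pi> | \<pi> permutes {..<N}. of_int (sign \<pi>) *
      (cnj (\<phi> (\<pi> 0) \<gamma>) * (one_body \<gamma> l (\<pi> l) * (\<Prod>i\<in>{..<N} - {0, l}. E i (\<pi> i)))))
    = rowdet N E * minor2 \<gamma> l"
  using rowdet_replace2_Leibniz[of 0 N l E "B \<gamma>" "one_body \<gamma> l"]
    rowdet_replace2[of 0 l "B \<gamma>" "one_body \<gamma> l"] assms
  by (simp add: B_def minor2_def)

lemma Leibniz_two_body:
  assumes "k \<in> {1..<N}" "l \<in> {1..<N}" "k \<noteq> l"
  shows "(\<Sum>\<pi> | \<pi> permutes {..<N}. of_int (sign \<pi>) *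
      (cnj (\<phi> (\<pi> 0) \<gamma>) * (two_body k l (\<pi> k) (\<pi> l) * (\<Prod>i\<in>{..<N} - {0, k, l}. E i (\<pi> i)))))
    = rowdet N E * minor3 \<gamma> k l"
proof -
  let ?e = "\<lambda>j m. if m = j then 1 else 0 :: complex"
  have e: "co (?e j) i = F j i" if "j < N" for j i
    using that by (simp add: row_coeff_def if_distrib[of "\<lambda>x. x * _"] cong: if_cong)
  have "rowdet N (E(0 := B \<gamma>, k := ?e j, l := two_body k l j)) = rowdet N E *
     (co (B \<gamma>) 0 * (F j k * co (two_body k l j) l - F j l * co (two_body k l j) k)
     - co (B \<gamma>) k * (F j 0 * co (two_body k l j) l - F j l * co (two_body k l j) 0)
     + co (B \<gamma>) l * (F j 0 * co (two_body k l j) k - F j k * co (two_body k l j) 0))" if "j < N" for j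
    using rowdet_replace3[of 0 k l "B \<gamma>" "?e j" "two_body k l j"] assms by (simp only: e[OF that]) auto
  then have "(\<Sum>j<N. rowdet N (E(0 := B \<gamma>, k := ?e j, l := two_body k l j))) = rowdet N E * minor3 \<gamma> k l"
    unfolding minor3_def sum_distrib_left by (intro sum.cong) auto
  then show ?thesis
    using rowdet_replace3_Leibniz[of 0 N k l "B \<gamma>" "two_body k l" E] assms N_pos
    by (simp only: B_def) auto
qed

lemma sum_pair_terms:
  "(\<Sum>k<N. \<Sum>l\<in>{..<N} - {k}. \<Sum>\<pi> | \<pi> permutes {..<N}.
      of_int (sign \<pi>) * (cnj (\<phi> (\<pi> 0) \<gamma>) * pair_term \<gamma> \<pi> k l))
    = rowdet N E * (2 * (\<Sum>l<N. minor2 \<gamma> l) + (\<Sum>k<N. \<Sum>l<N. minor3 \<gamma> k l))"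
proof -
  \<comment> \<open>One expression for all pairs of indices: \<open>minor3\<close> vanishes as soon
    as an index is 0, and \<open>X k k = 0\<close> also for k = 0, so the diagonal can be added.
    Each pair with particle 0 is counted in both orders, whence the factor 2.\<close>
  define X where "X k l = (if k = 0 then minor2 \<gamma> l else 0) + (if l = 0 then minor2 \<gamma> k else 0) + minor3 \<gamma> k l" for k l
  have "(\<Sum>\<pi> | \<pi> permutes {..<N}. of_int (sign \<pi>) * (cnj (\<phi> (\<pi> 0) \<gamma>) * pair_term \<gamma> \<pi> k l))
      = rowdet N E * X k l" if kl: "k < N" "l < N" "k \<noteq> l" for k l
  proof -
    consider "k = 0" "l \<in> {1..<N}" | "l = 0" "k \<in> {1..<N}" | "k \<in> {1..<N}" "l \<in> {1..<N}"
      using kl by (cases "k = 0"; cases "l = 0") auto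
    then show ?thesis
    proof cases
      case 1
      then show ?thesis using Leibniz_one_body[of l \<gamma>] by (simp add: pair_term_def X_def minor_degenerate)
    next
      case 2
      then show ?thesis using Leibniz_one_body[of k \<gamma>] by (simp add: pair_term_def X_def minor_degenerate)
    next
      case 3
      then show ?thesis using Leibniz_two_body[of k l \<gamma>] kl by (simp add: pair_term_def X_def)
    qed
  qed
  then have "(\<Sum>k<N. \<Sum>l\<in>{..<N} - {k}. \<Sum>\<pi> | \<pi> permutes {..<N}.
      of_int (sign \<pi>) * (cnj (\<phi> (\<pi> 0) \<gamma>) * pair_term \<gamma> \<pi> k l))
    = (\<Sum>k<N. \<Sum>l\<in>{..<N} - {k}. rowdet N E * X k l)"
    by (intro sum.cong) auto
  also have "\<dots> = (\<Sum>k<N. \<Sum>l<N. rowdet N E * X k l)"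
  proof (rule sum.cong[OF refl])
    fix k assume "k \<in> {..<N}"
    moreover have "X k k = 0" by (simp add: X_def minor_degenerate)
    ultimately show "(\<Sum>l\<in>{..<N} - {k}. rowdet N E * X k l) = (\<Sum>l<N. rowdet N E * X k l)"
      by (simp add: sum.remove[of _ k])
  qed
  also have "\<dots> = rowdet N E * (\<Sum>k<N. \<Sum>l<N. X k l)"
    by (simp add: sum_distrib_left)
  also have "(\<Sum>k<N. \<Sum>l<N. X k l) = 2 * (\<Sum>l<N. minor2 \<gamma> l) + (\<Sum>k<N. \<Sum>l<N. minor3 \<gamma> k l)"
  proof -
    have "(\<Sum>k<N. \<Sum>l<N. if k = 0 then minor2 \<gamma> l else 0) = (\<Sum>l<N. minor2 \<gamma> l)"
      by (subst sum.swap) (use N_pos in simp)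
    moreover have "(\<Sum>k<N. \<Sum>l<N. if l = 0 then minor2 \<gamma> k else 0) = (\<Sum>k<N. minor2 \<gamma> k)"
      using N_pos by simp
    ultimately show ?thesis by (simp add: X_def sum.distrib)
  qed
  finally show ?thesis .
qed

section \<open>The integrals of the closed formula as sums of minors\<close>

lemma \<beta>_eq: "\<beta> \<gamma> = co (B \<gamma>) 0"
  by (auto simp: \<beta>_def row_coeff_def B_def F_first_column intro!: sum.cong)

lemma \<theta>_\<beta>: "\<theta> i x * \<beta> x = (\<Sum>k<N. \<Sum>j<N. (F i k * F j 0) * pair k j x)"
  unfolding \<theta>_def \<beta>_eq row_coeff_def B_def sum_product
  by (intro sum.cong refl) (simp add: pair_def mult_ac)

lemma \<rho>_eq: "\<rho> x = (\<Sum>k<N. \<Sum>j<N. F j k * pair k j x)"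
  unfolding \<rho>_def \<theta>_def sum_distrib_left
  by (subst sum.swap) (intro sum.cong refl, simp add: pair_def mult_ac)

lemma poisson_\<theta>_\<beta>: "poisson (\<lambda>y. \<theta> i y * \<beta> y) x = (\<Sum>l<N. \<Sum>m<N. (F i l * F m 0) * one_body x l m)"
  by (rule poisson_expansion) (rule \<theta>_\<beta>)

lemma poisson_\<rho>: "poisson \<rho> x = (\<Sum>l<N. \<Sum>m<N. F m l * one_body x l m)"
  by (rule poisson_expansion) (rule \<rho>_eq)

lemma poisson_\<theta>_cnj:
  assumes "j < N"
  shows "poisson (\<lambda>y. \<theta> i y * cnj (\<phi> j y)) x = (\<Sum>l<N. F i l * one_body x l j)"
proof -
  have delta: "(\<Sum>m<N. (if m = j then F i l else 0) * g m) = F i l * g j" for l and g :: "nat \<Rightarrow> complex"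
    using assms by (simp add: if_distrib[of "\<lambda>x. x * _"] cong: if_cong)
  have "poisson (\<lambda>y. \<theta> i y * cnj (\<phi> j y)) x
      = (\<Sum>l<N. \<Sum>m<N. (if m = j then F i l else 0) * one_body x l m)"
    by (rule poisson_expansion) (simp add: delta \<theta>_def sum_distrib_right pair_def mult.assoc)
  then show ?thesis by (simp only: delta)
qed

text \<open>The two terms of T are the two products of a minor of order 2: \<rho> pairs each Coulomb
  row with its own column, while the convolutions of \<open>\<theta> j\<close> with \<beta> exchange
  the columns 0 and l.\<close>

lemma T_eq: "T \<gamma> = (\<Sum>l<N. minor2 \<gamma> l)"
proof -
  have "poisson \<rho> \<gamma> = (\<Sum>l<N. co (one_body \<gamma> l) l)"
    by (simp add: poisson_\<rho> row_coeff_def mult.commute)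
  moreover have "(\<Sum>j<N. cnj (\<phi> j \<gamma>) * poisson (\<lambda>y. \<theta> j y * \<beta> y) \<gamma>)
      = (\<Sum>l<N. co (B \<gamma>) l * co (one_body \<gamma> l) 0)"
  proof -
    have "poisson (\<lambda>y. \<theta> j y * \<beta> y) \<gamma> = (\<Sum>l<N. F j l * co (one_body \<gamma> l) 0)" for j
      unfolding poisson_\<theta>_\<beta> row_coeff_def sum_distrib_left
      by (intro sum.cong refl) (simp add: mult_ac)
    then have "(\<Sum>j<N. cnj (\<phi> j \<gamma>) * poisson (\<lambda>y. \<theta> j y * \<beta> y) \<gamma>)
        = (\<Sum>j<N. \<Sum>l<N. B \<gamma> j * F j l * co (one_body \<gamma> l) 0)"
      by (simp add: B_def sum_distrib_left mult.assoc)
    also have "\<dots> = (\<Sum>l<N. co (B \<gamma>) l * co (one_body \<gamma> l) 0)"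
      by (subst sum.swap) (simp add: row_coeff_def[of N F "B \<gamma>"] sum_distrib_right)
    finally show ?thesis .
  qed
  ultimately show ?thesis
    by (simp add: T_def \<beta>_eq minor2_def sum_subtractf sum_distrib_left)
qed

text \<open>The scalar product of \<rho> with its potential is the direct part; the matrix
  convolution is the exchange part, in which the columns k and l of the inverse are
  interchanged.\<close>

lemma c_eq: "c = (\<Sum>k<N. \<Sum>j<N. \<Sum>l<N. \<Sum>m<N. (F j k * F m l - F j l * F m k) * two_body k l j m)"
  unfolding c_def
proof (rule two_body_expansion)
  fix x
  have "\<rho> x * poisson \<rho> x
      = (\<Sum>k<N. \<Sum>j<N. \<Sum>l<N. \<Sum>m<N. (F j k * F m l) * (pair k j x * one_body x l m))"
    unfolding poisson_\<rho> \<rho>_eq sum_prod_expand by (simp only: mult_ac)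
  moreover have "(\<Sum>j<N. \<Sum>m<N. cnj (\<phi> j x) * (poisson (\<lambda>y. \<theta> j y * cnj (\<phi> m y)) x * \<theta> m x))
      = (\<Sum>j<N. \<Sum>m<N. \<Sum>l<N. \<Sum>k<N. (F j l * F m k) * (pair k j x * one_body x l m))"
  proof (intro sum.cong[OF refl])
    fix j m assume "m \<in> {..<N}"
    then have "m < N" by simp
    show "cnj (\<phi> j x) * (poisson (\<lambda>y. \<theta> j y * cnj (\<phi> m y)) x * \<theta> m x)
        = (\<Sum>l<N. \<Sum>k<N. (F j l * F m k) * (pair k j x * one_body x l m))"
      unfolding poisson_\<theta>_cnj[OF \<open>m < N\<close>] \<theta>_def[of m]
      unfolding sum_product
      unfolding sum_distrib_left
      by (intro sum.cong refl) (simp add: pair_def mult_ac)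
  qed
  moreover have "\<dots> = (\<Sum>k<N. \<Sum>j<N. \<Sum>l<N. \<Sum>m<N. (F j l * F m k) * (pair k j x * one_body x l m))"
    by (rule sum_permute4)
  ultimately show "\<rho> x * poisson \<rho> x - (\<Sum>i<N. \<Sum>j<N. cnj (\<phi> i x) *
     (poisson (\<lambda>y. \<theta> i y * cnj (\<phi> j y)) x * \<theta> j x)) = (\<Sum>k<N. \<Sum>j<N. \<Sum>l<N. \<Sum>m<N.
       (F j k * F m l - F j l * F m k) * (pair k j x * one_body x l m))"
    by (simp only: left_diff_distrib sum_subtractf)
qed

text \<open>\<open>F i k\<close> comes from \<open>\<theta> i\<close>; the bracket is the minor of
  order 2 that makes up T, written in entries of the inverse.\<close>

lemma H_eq:
  "H i = (\<Sum>k<N. \<Sum>j<N. \<Sum>l<N. \<Sum>m<N. (F i k * (F j 0 * F m l - F j l * F m 0)) * two_body k l j m)"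
  unfolding H_def
proof (rule two_body_expansion)
  fix x
  have "\<theta> i x * (\<beta> x * poisson \<rho> x)
      = (\<Sum>k<N. \<Sum>j<N. \<Sum>l<N. \<Sum>m<N. (F i k * (F j 0 * F m l)) * (pair k j x * one_body x l m))"
    unfolding poisson_\<rho> mult.assoc[symmetric] \<theta>_\<beta> sum_prod_expand by (simp only: mult_ac)
  moreover have "\<theta> i x * (\<Sum>j<N. cnj (\<phi> j x) * poisson (\<lambda>y. \<theta> j y * \<beta> y) x)
      = (\<Sum>k<N. \<Sum>j<N. \<Sum>l<N. \<Sum>m<N. (F i k * (F j l * F m 0)) * (pair k j x * one_body x l m))"
    unfolding poisson_\<theta>_\<beta> \<theta>_def[of i] sum_product
    by (simp add: sum_distrib_left pair_def mult_ac)
  ultimately show "\<theta> i x * T x = (\<Sum>k<N. \<Sum>j<N. \<Sum>l<N. \<Sum>m<N.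
      (F i k * (F j 0 * F m l - F j l * F m 0)) * (pair k j x * one_body x l m))"
    by (simp only: T_def right_diff_distrib left_diff_distrib sum_subtractf)
qed

text \<open>In the expansion along \<open>B \<gamma>\<close>, the first cofactor sums to c. The
  other two terms have equal sums, because exchanging the particles (k with l and j with m) maps one
  to the other; this is the origin of the factor 2 before H.\<close>

lemma sum_minor3:
  "(\<Sum>k<N. \<Sum>l<N. minor3 \<gamma> k l) = c * \<beta> \<gamma> - 2 * (\<Sum>i<N. H i * cnj (\<phi> i \<gamma>))"
proof -
  let ?V = "\<lambda>k l j m. two_body k l j m"
  let ?S = "\<lambda>f. \<Sum>k<N. \<Sum>l<N. \<Sum>j<N. \<Sum>m<N. f k l j m * ?V k l j m :: complex"
  have swap: "(\<Sum>k<N. \<Sum>j<N. \<Sum>l<N. \<Sum>m<N. f k l j m * ?V k l j m) = ?S f" for f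
    by (rule sum.cong[OF refl], rule sum.swap)
  have c: "c = ?S (\<lambda>k l j m. F j k * F m l - F j l * F m k)"
    unfolding c_eq by (rule swap)
  have "(\<Sum>i<N. H i * cnj (\<phi> i \<gamma>)) = (\<Sum>i<N. \<Sum>k<N. \<Sum>l<N. \<Sum>j<N. \<Sum>m<N.
      B \<gamma> i * F i k * ((F j 0 * F m l - F j l * F m 0) * ?V k l j m))"
    unfolding H_eq swap by (simp add: B_def sum_distrib_left mult_ac)
  also have "\<dots> = (\<Sum>k<N. \<Sum>i<N. \<Sum>l<N. \<Sum>j<N. \<Sum>m<N.
      B \<gamma> i * F i k * ((F j 0 * F m l - F j l * F m 0) * ?V k l j m))"
    by (rule sum.swap)
  also have "\<dots> = (\<Sum>k<N. \<Sum>l<N. \<Sum>j<N. \<Sum>m<N.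
      co (B \<gamma>) k * ((F j 0 * F m l - F j l * F m 0) * ?V k l j m))"
    by (simp only: row_coeff_def[of N F "B \<gamma>"] sum_distrib_left[symmetric] sum_distrib_right[symmetric])
  also have "\<dots> = ?S (\<lambda>k l j m. co (B \<gamma>) k * (F j 0 * F m l - F j l * F m 0))"
    by (simp only: mult.assoc)
  finally have H: "(\<Sum>i<N. H i * cnj (\<phi> i \<gamma>)) = ?S (\<lambda>k l j m. co (B \<gamma>) k * (F j 0 * F m l - F j l * F m 0))" .
  have sym: "?S (\<lambda>k l j m. co (B \<gamma>) l * (F j 0 * F m k - F j k * F m 0))
      = - ?S (\<lambda>k l j m. co (B \<gamma>) k * (F j 0 * F m l - F j l * F m 0))"
  proof -
    have "?S (\<lambda>k l j m. co (B \<gamma>) l * (F j 0 * F m k - F j k * F m 0))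
        = (\<Sum>l<N. \<Sum>k<N. \<Sum>m<N. \<Sum>j<N. co (B \<gamma>) l * (F j 0 * F m k - F j k * F m 0) * ?V k l j m)"
      by (subst sum.swap, rule sum.cong[OF refl], rule sum.cong[OF refl], rule sum.swap)
    also have "\<dots> = (\<Sum>l<N. \<Sum>k<N. \<Sum>m<N. \<Sum>j<N. - (co (B \<gamma>) l * (F m 0 * F j k - F m k * F j 0) * ?V l k m j))"
    proof (intro sum.cong refl)
      fix l k m j assume "l \<in> {..<N}" "k \<in> {..<N}" "m \<in> {..<N}" "j \<in> {..<N}"
      then have "?V k l j m = ?V l k m j" by (intro two_body_sym) auto
      then show "co (B \<gamma>) l * (F j 0 * F m k - F j k * F m 0) * ?V k l j m
          = - (co (B \<gamma>) l * (F m 0 * F j k - F m k * F j 0) * ?V l k m j)"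
        by (simp add: algebra_simps)
    qed
    finally show ?thesis by (simp add: sum_negf)
  qed
  have "minor3 \<gamma> k l = (\<Sum>j<N. \<Sum>m<N. co (B \<gamma>) 0 * ((F j k * F m l - F j l * F m k) * ?V k l j m)
      - co (B \<gamma>) k * (F j 0 * F m l - F j l * F m 0) * ?V k l j m
      + co (B \<gamma>) l * (F j 0 * F m k - F j k * F m 0) * ?V k l j m)" for k l
    unfolding minor3_def
  proof (rule sum.cong[OF refl])
    fix j
    have V: "co (?V k l j) i = (\<Sum>m<N. F m i * ?V k l j m)" for i
      by (simp add: row_coeff_def mult.commute)
    show "co (B \<gamma>) 0 * (F j k * co (?V k l j) l - F j l * co (?V k l j) k)
       - co (B \<gamma>) k * (F j 0 * co (?V k l j) l - F j l * co (?V k l j) 0)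
       + co (B \<gamma>) l * (F j 0 * co (?V k l j) k - F j k * co (?V k l j) 0)
      = (\<Sum>m<N. co (B \<gamma>) 0 * ((F j k * F m l - F j l * F m k) * ?V k l j m)
      - co (B \<gamma>) k * (F j 0 * F m l - F j l * F m 0) * ?V k l j m
      + co (B \<gamma>) l * (F j 0 * F m k - F j k * F m 0) * ?V k l j m)"
      unfolding V sum_distrib_left sum_subtractf[symmetric] sum.distrib[symmetric]
      by (intro sum.cong refl) (simp only: ring_distribs mult_ac)
  qed
  then have "(\<Sum>k<N. \<Sum>l<N. minor3 \<gamma> k l) = co (B \<gamma>) 0 * c - ?S (\<lambda>k l j m. co (B \<gamma>) k * (F j 0 * F m l - F j l * F m 0))
      + ?S (\<lambda>k l j m. co (B \<gamma>) l * (F j 0 * F m k - F j k * F m 0))"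
    unfolding c by (simp only: sum.distrib sum_subtractf sum_distrib_left)
  then show ?thesis
    unfolding sym H[symmetric] \<beta>_eq by simp
qed

lemma delta_braket_eq_closed_formula:
  "delta_braket N \<phi>t (\<lambda>x. coulomb N x * (\<Prod>i<N. \<phi> i (x i))) = closed_formula N \<phi> \<phi>t d"
  by (rule ext) (simp add: delta_braket_expansion sum_pair_terms rowdet_E T_eq sum_minor3 closed_formula_scalar)

end

theorem proposition18:
  shows
    "(\<forall>N \<phi> \<phi>t d. nonsingular_setting N \<phi> \<phi>t d \<longrightarrow>
        delta_braket N \<phi>t (\<lambda>x. coulomb N x * (\<Prod>i<N. \<phi> i (x i)))
          = closed_formula N \<phi> \<phi>t d) \<and>
     (\<exists>P :: nat \<Rightarrow> instr list.
        (\<forall>N \<phi> \<phi>t d svd. nonsingular_setting N \<phi> \<phi>t d \<and> svd_routine N svd \<longrightarrow>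
           program_output N svd \<phi> \<phi>t (P N) = closed_formula N \<phi> \<phi>t d) \<and>
        (\<forall>cS cF cW cL.
           cF \<in> O(\<lambda>M. real M) \<and> cW \<in> O(\<lambda>M. real M * ln (real M)) \<and> cL \<in> O(\<lambda>N. real N ^ 3) \<longrightarrow>
           (\<exists>C. \<forall>N M. 1 \<le> N \<and> N \<le> M \<longrightarrow>
              program_cost cS cF cW cL N M (P N)
                \<le> C * (real N ^ 3 + real N ^ 2 * (real M * ln (real M))))))"
proof (intro conjI exI[of _ formula_code] allI impI; (elim conjE)?)
  fix N \<phi> \<phi>t d assume "nonsingular_setting N \<phi> \<phi>t d"
  then interpret orbitals_setting N \<phi> \<phi>t d by unfold_locales
  show "delta_braket N \<phi>t (\<lambda>x. coulomb N x * (\<Prod>i<N. \<phi> i (x i))) = closed_formula N \<phi> \<phi>t d"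
    by (rule delta_braket_eq_closed_formula)
next
  fix N \<phi> \<phi>t d svd assume ns: "nonsingular_setting N \<phi> \<phi>t d" and svd: "svd_routine N svd"
  interpret given: orbitals_setting N \<phi> \<phi>t d using ns by unfold_locales
  interpret found: orbitals_setting N \<phi> \<phi>t "svd_null_vector N svd \<phi> \<phi>t"
    using nonsingular_setting_svd[OF ns svd] by unfold_locales
  interpret machine N svd \<phi> \<phi>t .
  have "program_output N svd \<phi> \<phi>t (formula_code N) = closed_formula N \<phi> \<phi>t (svd_null_vector N svd \<phi> \<phi>t)"
    using run_formula_code found.inverse_carrier found.N_pos by simp
  then show "program_output N svd \<phi> \<phi>t (formula_code N) = closed_formula N \<phi> \<phi>t d"
    by (simp only: found.delta_braket_eq_closed_formula[symmetric] given.delta_braket_eq_closed_formula[symmetric])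
next
  fix cS :: real and cF cW cL :: "nat \<Rightarrow> real"
  assume "cF \<in> O(\<lambda>M. real M)" "cW \<in> O(\<lambda>M. real M * ln (real M))" "cL \<in> O(\<lambda>N. real N ^ 3)"
  then show "\<exists>C. \<forall>N M. 1 \<le> N \<and> N \<le> M \<longrightarrow>
      program_cost cS cF cW cL N M (formula_code N) \<le> C * (real N ^ 3 + real N ^ 2 * (real M * ln (real M)))"
    by (rule formula_code_cost)
qed

end
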